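(* Let $(X,\Sigma,\mathfrak m)$ be a probability space, $(\Omega,\mathsf d)$ a compact metric space, and $M$ a countably-generated complete random normed module with base $(X,\Sigma,\mathfrak m)$. Let $\mu\in\mathfrak M(\Omega;M)$ be a Radon $M$-valued measure. Then $\mu$ admits a foliation $(\mu_x)_{x\in X}$. Moreover, letting $(|\mu|_x)_{x\in X}$ be the $\mathfrak m$-a.e. unique foliation of $|\mu|\in\mathfrak M_+(\Omega;L^0(\mathfrak m))$, it holds that \[ \|\mu_x\|_x\le|\mu|_x\quad\text{ for }\mathfrak m\text{-a.e. }x\in X, \] where $\|\mu_x\|_x\in\mathfrak M_+(\Omega)$ denotes the total variation measure of $\mu_x$.
   Context: $L^0(\mathfrak m)$ is the algebra of $\mathfrak m$-a.e. equivalence classes $[f]_{\mathfrak m}$ of measurable functions $X\to\mathbb R$, with the $\mathfrak m$-a.e. order and the distance $\int|f-g|\wedge1\,\mathrm d\mathfrak m$; $L^0_+(\mathfrak m)$ is its positive cone; $\bar L^0(\mathfrak m)$ is the complete lattice of classes of $[-\infty,+\infty]$-valued measurable functions, in which $\bigvee,\bigwedge$ are taken. Maps on $X$ are $\mathfrak m$-measurable if they are measurable with respect to the $\mathfrak m$-completion of $\Sigma$; classes modulo $\mathfrak m$-a.e. equality of such maps are identified with classes of $\Sigma$-measurable ones. A sequence in $L^0_+(\mathfrak m)$ is summable if its partial sums are order bounded in $L^0(\mathfrak m)$. A random normed module with base $(X,\Sigma,\mathfrak m)$ is a module $M$ over $L^0(\mathfrak m)$ with a map $|\cdot|\colon M\to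 L^0_+(\mathfrak m)$ such that $|v|=0$ iff $v=0$, $|v+w|\le|v|+|w|$, $|f\cdot v|=|f||v|$; it is complete if $d_M(v,w)=\int|v-w|\wedge1\,\mathrm d\mathfrak m$ is complete, and countably generated if there is a countable $C\subseteq M$ whose generated $L^0(\mathfrak m)$-submodule is dense in $M$. An $M$-valued measure is a map $\mu\colon\mathscr B(\Omega)\to M$ with $\mu(\varnothing)=0$ such that for pairwise disjoint Borel sets $(A_n)$ the sequence $(|\mu(A_n)|)_n$ is summable and $\mu(\bigcup_nA_n)=\sum_n\mu(A_n)$ (limit in $M$). Put $|\mu|(A)=\bigvee\{\sum_n|\mu(A_n)|:(A_n)_{n\in\mathbb N}\text{ Borel partition of }A\}$; $\mu$ is of bounded variation if $|\mu|(\Omega)\in L^0_+(\mathfrak m)$, in which case $|\mu|$ is a non-negative $L^0(\mathfrak m)$-valued measure. $\mu$ is Radon ($\mu\in\mathfrak M(\Omega;M)$) if it is of bounded variation, $|\mu|(U)=\bigvee\{|\mu|(K):K\subseteq U\text{ compact}\}$ for all open $U$, and $|\mu|(B)=\bigwedge\{|\mu|(U):U\text{ open},\,B\subseteq U\}$ for all Borel $B$. $\mathfrak M_+(\Omega;L^0(\mathfrak m))$ is the set of non-negative Radon $L^0(\mathfrak m)$-valued measures. A foliation of $\nu\in\mathfrak M_+(\Omega;L^0(\mathfrak m))$ is a family $(\nu_x)_{x\in X}$ of finite Radon measures on $\Omega$ such that for every Borel $A$ the function $x\mapsto\nu_x(A)$ is $\mathfrak m$-measurable and $\nu(A)=[\nu_\cdot(A)]_{\mathfrak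 m}$; on a compact metric space it is known to exist and to be unique up to an $\mathfrak m$-null set of $x$. Bundles: fix a separable Banach space $\mathbb U$ into which every separable Banach space embeds linearly and isometrically. A measurable Banach $\mathbb U$-bundle is a map $E$ assigning to each $x\in X$ a closed vector subspace $E(x)\subseteq\mathbb U$ such that $\{x:E(x)\cap U\ne\varnothing\}\in\Sigma$ for every open $U\subseteq\mathbb U$. $\Gamma(E)$ is the space of measurable maps $v\colon X\to\mathbb U$ with $v(x)\in E(x)$ for all $x$, modulo $\mathfrak m$-a.e. equality; it is a complete random normed module with pointwise operations and $|v|(x)=\|v(x)\|_{\mathbb U}$. It is known that for every countably-generated complete random normed module $M$ there is an (essentially unique) measurable Banach $\mathbb U$-bundle $E_M$ with $\Gamma(E_M)$ isometrically isomorphic to $M$; such a bundle and such an identification $M\cong\Gamma(E_M)$ are fixed, and one sets $(M_x,\|\cdot\|_x):=(E_M(x),\|\cdot\|_{\mathbb U})$. A foliation of an $M$-valued measure $\mu$ of bounded variation is a family $(\mu_x)_{x\in X}$ such that: (i) each $\mu_x\colon\mathscr B(\Omega)\to M_x$ is a countably additive vector measure of bounded variation; (ii) $x\mapsto\mu_x(A)\in\mathbb U$ is $\mathfrak m$-measurable for every $A\in\mathscr B(\Omega)$; (iii) for every $A\in\mathscr B(\Omega)$, $\mu(A)\in M\cong\Gamma(E_M)$ is the $\mathfrak m$-a.e. equivalence class of the section $x\mapsto\mu_x(A)$. *)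

theory Defs
  imports "HOL-Probability.Probability" "HOL-Algebra.Module" "HOL-Algebra.Lattice"
begin

section \<open>The algebra \<open>L\<^sup>0(m)\<close> and its order completion\<close>

text \<open>
  A class modulo m-a.e. equality is represented by the set of its measurable members. If \<open>f\<close> is
  only measurable with respect to the completion of \<open>m\<close>, then \<open>ae_class m N f\<close> is the class of
  the measurable functions that agree with \<open>f\<close> almost everywhere, as usual.
\<close>

definition ae_class :: "'x measure \<Rightarrow> 'a measure \<Rightarrow> ('x \<Rightarrow> 'a) \<Rightarrow> ('x \<Rightarrow> 'a) set" where
  "ae_class m N f = {g \<in> measurable m N. AE x in m. g x = f x}"

definition rep :: "('x \<Rightarrow> 'a) set \<Rightarrow> 'x \<Rightarrow> 'a" where
  "rep F = (SOME f. f \<in> F)"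

definition L0 :: "'x measure \<Rightarrow> ('x \<Rightarrow> real) set ring" where
  "L0 m = \<lparr>carrier = ae_class m borel ` borel_measurable m,
           mult = (\<lambda>F G. ae_class m borel (\<lambda>x. rep F x * rep G x)),
           one = ae_class m borel (\<lambda>_. 1),
           zero = ae_class m borel (\<lambda>_. 0),
           add = (\<lambda>F G. ae_class m borel (\<lambda>x. rep F x + rep G x))\<rparr>"

definition ae_le :: "'x measure \<Rightarrow> ('x \<Rightarrow> 'a::order) set \<Rightarrow> ('x \<Rightarrow> 'a) set \<Rightarrow> bool" where
  "ae_le m F G \<longleftrightarrow> (AE x in m. rep F x \<le> rep G x)"

definition L0_pos :: "'x measure \<Rightarrow> ('x \<Rightarrow> real) set set" where
  "L0_pos m = {F \<in> carrier (L0 m). ae_le m \<zero>\<^bsub>L0 m\<^esub> F}"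

definition L0_abs :: "'x measure \<Rightarrow> ('x \<Rightarrow> real) set \<Rightarrow> ('x \<Rightarrow> real) set" where
  "L0_abs m F = ae_class m borel (\<lambda>x. \<bar>rep F x\<bar>)"

definition L0_bar :: "'x measure \<Rightarrow> ('x \<Rightarrow> ereal) set gorder" where
  "L0_bar m = \<lparr>carrier = ae_class m borel ` borel_measurable m, eq = (=), le = ae_le m\<rparr>"

definition L0_to_bar :: "'x measure \<Rightarrow> ('x \<Rightarrow> real) set \<Rightarrow> ('x \<Rightarrow> ereal) set" where
  "L0_to_bar m F = ae_class m borel (\<lambda>x. ereal (rep F x))"

text \<open>The inverse of \<open>L0_to_bar m\<close> on its range.\<close>

definition L0_of_bar :: "'x measure \<Rightarrow> ('x \<Rightarrow> ereal) set \<Rightarrow> ('x \<Rightarrow> real) set" where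
  "L0_of_bar m F = ae_class m borel (\<lambda>x. real_of_ereal (rep F x))"

definition L0_summable :: "'x measure \<Rightarrow> (nat \<Rightarrow> ('x \<Rightarrow> real) set) \<Rightarrow> bool" where
  "L0_summable m F \<longleftrightarrow>
     (\<exists>G \<in> carrier (L0 m). \<forall>N. ae_le m (\<Oplus>\<^bsub>L0 m\<^esub>n\<in>{..<N}. F n) G)"

text \<open>The sum of a sequence of non-negative classes, which always exists in the order completion.\<close>

definition L0_suminf :: "'x measure \<Rightarrow> (nat \<Rightarrow> ('x \<Rightarrow> real) set) \<Rightarrow> ('x \<Rightarrow> ereal) set" where
  "L0_suminf m F = ae_class m borel (\<lambda>x. \<Sum>n. ereal (rep (F n) x))"


section \<open>Random normed modules\<close>

locale random_normed_module =
  fixes m :: "'x measure" and M :: "(('x \<Rightarrow> real) set, 'v) module"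
    and rnorm :: "'v \<Rightarrow> ('x \<Rightarrow> real) set"
  assumes base: "prob_space m"
    and L0_module: "Module.module (L0 m) M"
    and rnorm_pos: "v \<in> carrier M \<Longrightarrow> rnorm v \<in> L0_pos m"
    and rnorm_eq_zero_iff: "v \<in> carrier M \<Longrightarrow> rnorm v = \<zero>\<^bsub>L0 m\<^esub> \<longleftrightarrow> v = \<zero>\<^bsub>M\<^esub>"
    and rnorm_triangle: "v \<in> carrier M \<Longrightarrow> w \<in> carrier M \<Longrightarrow>
      ae_le m (rnorm (v \<oplus>\<^bsub>M\<^esub> w)) (rnorm v \<oplus>\<^bsub>L0 m\<^esub> rnorm w)"
    and rnorm_smult: "f \<in> carrier (L0 m) \<Longrightarrow> v \<in> carrier M \<Longrightarrow>
      rnorm (f \<odot>\<^bsub>M\<^esub> v) = L0_abs m f \<otimes>\<^bsub>L0 m\<^esub> rnorm v"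

text \<open>
  The locale \<open>Metric_space\<close> asks for non-negativity and symmetry also off the carrier, hence the
  case distinction.
\<close>

definition carrier_dist :: "('r, 'v) module \<Rightarrow> ('v \<Rightarrow> real) \<Rightarrow> 'v \<Rightarrow> 'v \<Rightarrow> real" where
  "carrier_dist V p v w = (if v \<in> carrier V \<and> w \<in> carrier V then p (v \<ominus>\<^bsub>V\<^esub> w) else 0)"

definition rdist ::
  "'x measure \<Rightarrow> (('x \<Rightarrow> real) set, 'v) module \<Rightarrow> ('v \<Rightarrow> ('x \<Rightarrow> real) set) \<Rightarrow> 'v \<Rightarrow> 'v \<Rightarrow> real" where
  "rdist m M rnorm = carrier_dist M (\<lambda>v. LINT x|m. min (rep (rnorm v) x) 1)"

abbreviation rtopology ::
  "'x measure \<Rightarrow> (('x \<Rightarrow> real) set, 'v) module \<Rightarrow> ('v \<Rightarrow> ('x \<Rightarrow> real) set) \<Rightarrow> 'v topology" where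
  "rtopology m M rnorm \<equiv> Metric_space.mtopology (carrier M) (rdist m M rnorm)"

definition complete_rnm ::
  "'x measure \<Rightarrow> (('x \<Rightarrow> real) set, 'v) module \<Rightarrow> ('v \<Rightarrow> ('x \<Rightarrow> real) set) \<Rightarrow> bool" where
  "complete_rnm m M rnorm \<longleftrightarrow> Metric_space.mcomplete (carrier M) (rdist m M rnorm)"

definition countably_generated_rnm ::
  "'x measure \<Rightarrow> (('x \<Rightarrow> real) set, 'v) module \<Rightarrow> ('v \<Rightarrow> ('x \<Rightarrow> real) set) \<Rightarrow> bool" where
  "countably_generated_rnm m M rnorm \<longleftrightarrow>
     (\<exists>C. countable C \<and> C \<subseteq> carrier M \<and>
        rtopology m M rnorm closure_of (\<Inter>{H. submodule H (L0 m) M \<and> C \<subseteq> H}) = carrier M)"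


section \<open>Module-valued measures\<close>

abbreviation borel_sets :: "'o::topological_space set \<Rightarrow> 'o set set" where
  "borel_sets \<Omega> \<equiv> sets (restrict_space borel \<Omega>)"

text \<open>Partitions are sequences whose members may be empty, so finite partitions are included.\<close>

definition borel_partitions :: "'o::topological_space set \<Rightarrow> 'o set \<Rightarrow> (nat \<Rightarrow> 'o set) set" where
  "borel_partitions \<Omega> A =
     {P. range P \<subseteq> borel_sets \<Omega> \<and> disjoint_family P \<and> (\<Union>n. P n) = A}"

definition module_measure ::
  "'x measure \<Rightarrow> (('x \<Rightarrow> real) set, 'v) module \<Rightarrow> ('v \<Rightarrow> ('x \<Rightarrow> real) set) \<Rightarrow>
   'o::topological_space set \<Rightarrow> ('o set \<Rightarrow> 'v) \<Rightarrow> bool" where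
  "module_measure m M rnorm \<Omega> \<mu> \<longleftrightarrow>
     (\<forall>A \<in> borel_sets \<Omega>. \<mu> A \<in> carrier M) \<and> \<mu> {} = \<zero>\<^bsub>M\<^esub> \<and>
     (\<forall>A. range A \<subseteq> borel_sets \<Omega> \<and> disjoint_family A \<longrightarrow>
        L0_summable m (\<lambda>n. rnorm (\<mu> (A n))) \<and>
        limitin (rtopology m M rnorm) (\<lambda>N. \<Oplus>\<^bsub>M\<^esub>n\<in>{..<N}. \<mu> (A n)) (\<mu> (\<Union>n. A n)) sequentially)"

definition mvar ::
  "'x measure \<Rightarrow> ('v \<Rightarrow> ('x \<Rightarrow> real) set) \<Rightarrow> 'o::topological_space set \<Rightarrow> ('o set \<Rightarrow> 'v) \<Rightarrow>
   'o set \<Rightarrow> ('x \<Rightarrow> ereal) set" where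
  "mvar m rnorm \<Omega> \<mu> A =
     \<Squnion>\<^bsub>L0_bar m\<^esub> {L0_suminf m (\<lambda>n. rnorm (\<mu> (P n))) | P. P \<in> borel_partitions \<Omega> A}"

definition bounded_variation ::
  "'x measure \<Rightarrow> ('v \<Rightarrow> ('x \<Rightarrow> real) set) \<Rightarrow> 'o::topological_space set \<Rightarrow> ('o set \<Rightarrow> 'v) \<Rightarrow> bool" where
  "bounded_variation m rnorm \<Omega> \<mu> \<longleftrightarrow> mvar m rnorm \<Omega> \<mu> \<Omega> \<in> L0_to_bar m ` L0_pos m"

text \<open>The variation of a measure of bounded variation, with values in \<open>L\<^sup>0(m)\<close>.\<close>

definition L0_mvar ::
  "'x measure \<Rightarrow> ('v \<Rightarrow> ('x \<Rightarrow> real) set) \<Rightarrow> 'o::topological_space set \<Rightarrow> ('o set \<Rightarrow> 'v) \<Rightarrow>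
   'o set \<Rightarrow> ('x \<Rightarrow> real) set" where
  "L0_mvar m rnorm \<Omega> \<mu> A = L0_of_bar m (mvar m rnorm \<Omega> \<mu> A)"

definition radon_module_measure ::
  "'x measure \<Rightarrow> (('x \<Rightarrow> real) set, 'v) module \<Rightarrow> ('v \<Rightarrow> ('x \<Rightarrow> real) set) \<Rightarrow>
   'o::topological_space set \<Rightarrow> ('o set \<Rightarrow> 'v) \<Rightarrow> bool" where
  "radon_module_measure m M rnorm \<Omega> \<mu> \<longleftrightarrow>
     module_measure m M rnorm \<Omega> \<mu> \<and> bounded_variation m rnorm \<Omega> \<mu> \<and>
     (\<forall>U. openin (top_of_set \<Omega>) U \<longrightarrow>
        mvar m rnorm \<Omega> \<mu> U = \<Squnion>\<^bsub>L0_bar m\<^esub> {mvar m rnorm \<Omega> \<mu> K | K. compact K \<and> K \<subseteq> U}) \<and>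
     (\<forall>B \<in> borel_sets \<Omega>.
        mvar m rnorm \<Omega> \<mu> B =
          \<Sqinter>\<^bsub>L0_bar m\<^esub> {mvar m rnorm \<Omega> \<mu> U | U. openin (top_of_set \<Omega>) U \<and> B \<subseteq> U})"

definition finite_radon_measure :: "'o::topological_space set \<Rightarrow> 'o measure \<Rightarrow> bool" where
  "finite_radon_measure \<Omega> \<nu> \<longleftrightarrow>
     finite_measure \<nu> \<and> space \<nu> = \<Omega> \<and> sets \<nu> = borel_sets \<Omega> \<and>
     (\<forall>U. openin (top_of_set \<Omega>) U \<longrightarrow> emeasure \<nu> U = (SUP K\<in>{K. compact K \<and> K \<subseteq> U}. emeasure \<nu> K)) \<and>
     (\<forall>B \<in> borel_sets \<Omega>.
        emeasure \<nu> B = (INF U\<in>{U. openin (top_of_set \<Omega>) U \<and> B \<subseteq> U}. emeasure \<nu> U))"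

definition L0_foliation ::
  "'x measure \<Rightarrow> 'o::topological_space set \<Rightarrow> ('o set \<Rightarrow> ('x \<Rightarrow> real) set) \<Rightarrow> ('x \<Rightarrow> 'o measure) \<Rightarrow> bool" where
  "L0_foliation m \<Omega> \<nu> \<kappa> \<longleftrightarrow>
     (\<forall>x \<in> space m. finite_radon_measure \<Omega> (\<kappa> x)) \<and>
     (\<forall>A \<in> borel_sets \<Omega>.
        (\<lambda>x. measure (\<kappa> x) A) \<in> borel_measurable (completion m) \<and>
        \<nu> A = ae_class m borel (\<lambda>x. measure (\<kappa> x) A))"


section \<open>Universal separable Banach spaces\<close>

definition real_ring :: "real ring" where
  "real_ring = \<lparr>carrier = UNIV, mult = (*), one = 1, zero = 0, add = (+)\<rparr>"

definition separable_banach_space :: "(real, 'v) module \<Rightarrow> ('v \<Rightarrow> real) \<Rightarrow> bool" where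
  "separable_banach_space V p \<longleftrightarrow>
     Module.module real_ring V \<and>
     (\<forall>v \<in> carrier V. p v \<ge> 0 \<and> (p v = 0 \<longleftrightarrow> v = \<zero>\<^bsub>V\<^esub>)) \<and>
     (\<forall>v \<in> carrier V. \<forall>w \<in> carrier V. p (v \<oplus>\<^bsub>V\<^esub> w) \<le> p v + p w) \<and>
     (\<forall>c. \<forall>v \<in> carrier V. p (c \<odot>\<^bsub>V\<^esub> v) = \<bar>c\<bar> * p v) \<and>
     Metric_space.mcomplete (carrier V) (carrier_dist V p) \<and>
     separable_space (Metric_space.mtopology (carrier V) (carrier_dist V p))"

text \<open>
  A separable metric space has at most the cardinality of the continuum, so every separable Banach
  space has an isometric copy whose carrier is a set of reals (with transported operations). Hence
  quantifying over such copies amounts to quantifying over all separable Banach spaces.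
\<close>

definition universal_separable_banach :: "'u::{banach, second_countable_topology} itself \<Rightarrow> bool" where
  "universal_separable_banach _ \<longleftrightarrow>
     (\<forall>(V :: (real, real) module) p. separable_banach_space V p \<longrightarrow>
        (\<exists>T :: real \<Rightarrow> 'u.
           (\<forall>v \<in> carrier V. \<forall>w \<in> carrier V. T (v \<oplus>\<^bsub>V\<^esub> w) = T v + T w) \<and>
           (\<forall>c. \<forall>v \<in> carrier V. T (c \<odot>\<^bsub>V\<^esub> v) = c *\<^sub>R T v) \<and>
           (\<forall>v \<in> carrier V. norm (T v) = p v)))"


section \<open>Measurable Banach bundles\<close>

definition measurable_banach_bundle ::
  "'x measure \<Rightarrow> ('x \<Rightarrow> 'u::{banach, second_countable_topology} set) \<Rightarrow> bool" where
  "measurable_banach_bundle m E \<longleftrightarrow>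
     (\<forall>x \<in> space m. subspace (E x) \<and> closed (E x)) \<and>
     (\<forall>U. open U \<longrightarrow> {x \<in> space m. E x \<inter> U \<noteq> {}} \<in> sets m)"

definition sections ::
  "'x measure \<Rightarrow> ('x \<Rightarrow> 'u::{banach, second_countable_topology} set) \<Rightarrow> ('x \<Rightarrow> 'u) set" where
  "sections m E = {v \<in> borel_measurable m. \<forall>x \<in> space m. v x \<in> E x}"

definition section_class ::
  "'x measure \<Rightarrow> ('x \<Rightarrow> 'u::{banach, second_countable_topology} set) \<Rightarrow> ('x \<Rightarrow> 'u) \<Rightarrow> ('x \<Rightarrow> 'u) set" where
  "section_class m E v = {w \<in> sections m E. AE x in m. w x = v x}"

text \<open>
  The type \<open>module\<close> extends \<open>ring\<close>; a module has no multiplication of its own and no unit, so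
  these two fields are left undefined.
\<close>

definition section_module ::
  "'x measure \<Rightarrow> ('x \<Rightarrow> 'u::{banach, second_countable_topology} set) \<Rightarrow>
   (('x \<Rightarrow> real) set, ('x \<Rightarrow> 'u) set) module" where
  "section_module m E =
     \<lparr>carrier = section_class m E ` sections m E,
      mult = undefined,
      one = undefined,
      zero = section_class m E (\<lambda>_. 0),
      add = (\<lambda>V W. section_class m E (\<lambda>x. rep V x + rep W x)),
      smult = (\<lambda>F V. section_class m E (\<lambda>x. rep F x *\<^sub>R rep V x))\<rparr>"

definition section_norm ::
  "'x measure \<Rightarrow> ('x \<Rightarrow> 'u::{banach, second_countable_topology}) set \<Rightarrow> ('x \<Rightarrow> real) set" where
  "section_norm m V = ae_class m borel (\<lambda>x. norm (rep V x))"

definition rnm_iso ::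
  "'x measure \<Rightarrow> (('x \<Rightarrow> real) set, 'v) module \<Rightarrow> ('v \<Rightarrow> ('x \<Rightarrow> real) set) \<Rightarrow>
   (('x \<Rightarrow> real) set, 'w) module \<Rightarrow> ('w \<Rightarrow> ('x \<Rightarrow> real) set) \<Rightarrow> ('v \<Rightarrow> 'w) \<Rightarrow> bool" where
  "rnm_iso m M rnorm N rnorm' \<Phi> \<longleftrightarrow>
     bij_betw \<Phi> (carrier M) (carrier N) \<and>
     (\<forall>v \<in> carrier M. \<forall>w \<in> carrier M. \<Phi> (v \<oplus>\<^bsub>M\<^esub> w) = \<Phi> v \<oplus>\<^bsub>N\<^esub> \<Phi> w) \<and>
     (\<forall>f \<in> carrier (L0 m). \<forall>v \<in> carrier M. \<Phi> (f \<odot>\<^bsub>M\<^esub> v) = f \<odot>\<^bsub>N\<^esub> \<Phi> v) \<and>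
     (\<forall>v \<in> carrier M. rnorm' (\<Phi> v) = rnorm v)"


section \<open>Foliations\<close>

definition total_variation ::
  "'o::topological_space set \<Rightarrow> ('o set \<Rightarrow> 'u::real_normed_vector) \<Rightarrow> 'o set \<Rightarrow> ennreal" where
  "total_variation \<Omega> \<nu> A = (SUP P\<in>borel_partitions \<Omega> A. \<Sum>n. ennreal (norm (\<nu> (P n))))"

definition bv_vector_measure ::
  "'o::topological_space set \<Rightarrow> 'u::real_normed_vector set \<Rightarrow> ('o set \<Rightarrow> 'u) \<Rightarrow> bool" where
  "bv_vector_measure \<Omega> F \<nu> \<longleftrightarrow>
     (\<forall>A \<in> borel_sets \<Omega>. \<nu> A \<in> F) \<and> \<nu> {} = 0 \<and>
     (\<forall>A. range A \<subseteq> borel_sets \<Omega> \<and> disjoint_family A \<longrightarrow> (\<lambda>n. \<nu> (A n)) sums \<nu> (\<Union>n. A n)) \<and>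
     total_variation \<Omega> \<nu> \<Omega> < \<infinity>"

text \<open>Here \<open>\<Phi>\<close> is the chosen identification of the module with the space of sections of \<open>E\<close>.\<close>

definition foliation ::
  "'x measure \<Rightarrow> ('x \<Rightarrow> 'u::{banach, second_countable_topology} set) \<Rightarrow> ('v \<Rightarrow> ('x \<Rightarrow> 'u) set) \<Rightarrow>
   'o::topological_space set \<Rightarrow> ('o set \<Rightarrow> 'v) \<Rightarrow> ('x \<Rightarrow> 'o set \<Rightarrow> 'u) \<Rightarrow> bool" where
  "foliation m E \<Phi> \<Omega> \<mu> \<mu>x \<longleftrightarrow>
     (\<forall>x \<in> space m. bv_vector_measure \<Omega> (E x) (\<mu>x x)) \<and>
     (\<forall>A \<in> borel_sets \<Omega>. (\<lambda>x. \<mu>x x A) \<in> borel_measurable (completion m)) \<and>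
     (\<forall>A \<in> borel_sets \<Omega>. \<Phi> (\<mu> A) = section_class m E (\<lambda>x. \<mu>x x A))"

end

theory Submission
  imports Defs
begin

text \<open>
  Choosing a representative \<open>R (\<mu> A)\<close> of the section \<open>\<Phi> (\<mu> A)\<close> for every Borel set \<open>A\<close> gives set
  functions that are additive only up to null sets depending on the sets involved. On countably
  many sets this is harmless, so \<open>\<Omega>\<close> is replaced by the Cantor space, whose cylinders form a
  countable algebra of compact open sets: a compact metric space is a Borel retract of it. Almost
  every fibre is then a finitely additive function on cylinders of bounded variation. Its variation
  is countably additive on cylinders by compactness, and a vector-valued additive function dominated
  by a finite measure extends to the generated \<open>\<sigma>\<close>-algebra by \<open>L\<^sup>1\<close>-density. No disintegration of
  \<open>|\<mu>|\<close> is needed. That the fibres represent \<open>\<mu>\<close> on all Borel sets follows from a \<open>\<pi>\<close>-\<open>\<lambda>\<close> argument.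
  The bound by \<open>|\<mu>|\<^sub>x\<close> holds for a.e. \<open>x\<close> on all cylinders simultaneously, and the same
  extension result, together with uniqueness, carries it over to all Borel sets.
\<close>


section \<open>Representatives of classes and sections\<close>

text \<open>The obstacle is the order of quantifiers: a foliation needs one null set of bad points,
  fixed before the Borel set is. Only countably many requirements can be imposed on the
  representatives, here additivity for pairs of cylinders and one bound per level on the norms
  summed over the cells of that level. The bound is a finite representative of |\<mu>|(\<Omega>),
  the same for all levels. On an arbitrary countable algebra generating the Borel sets such
  requirements would not exclude a purely finitely additive fibre; compact cylinders exclude it.

  Only \<sigma>-algebras are transported, so the coding \<open>\<phi>\<close> and its left inverse
  \<open>\<psi>\<close> may be discontinuous: \<mu> is pushed forward along \<open>\<phi>\<close>,
  and the fibres u_x found on the Cantor space are read back as \<mu>_x(A) = u_x(\<psi>^{-1}(A)),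
  because \<phi>^{-1}(\<psi>^{-1}(A)) = A.

  For the inequality it suffices to bound the norm of each value \<mu>_x(A): a measure that
  dominates these norms dominates the total variation.\<close>

lemma AE_eq_cong:
  assumes "AE x in m. f x = g x"
  shows "(AE x in m. h x = f x) \<longleftrightarrow> (AE x in m. h x = g x)"
proof
  assume "AE x in m. h x = f x"
  with assms show "AE x in m. h x = g x" by eventually_elim simp
next
  assume "AE x in m. h x = g x"
  with assms show "AE x in m. h x = f x" by eventually_elim simp
qed

lemma ae_class_cong: "AE x in m. f x = g x \<Longrightarrow> ae_class m N f = ae_class m N g"
  unfolding ae_class_def by (intro Collect_cong conj_cong refl AE_eq_cong)

lemma rep_in: "f \<in> F \<Longrightarrow> rep F \<in> F"
  unfolding rep_def by (rule someI[where P = "\<lambda>f. f \<in> F"])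

lemma rep_ae_class:
  assumes "f \<in> measurable m N"
  shows "rep (ae_class m N f) \<in> measurable m N" "AE x in m. rep (ae_class m N f) x = f x"
proof -
  have "f \<in> ae_class m N f" using assms by (simp add: ae_class_def)
  then have "rep (ae_class m N f) \<in> ae_class m N f" by (rule rep_in)
  then show "rep (ae_class m N f) \<in> measurable m N" "AE x in m. rep (ae_class m N f) x = f x"
    by (auto simp: ae_class_def)
qed

lemma ae_class_rep:
  assumes "F \<in> ae_class m N ` measurable m N"
  shows "rep F \<in> measurable m N" "ae_class m N (rep F) = F"
proof -
  obtain f where f: "f \<in> measurable m N" "F = ae_class m N f" using assms by blast
  show "rep F \<in> measurable m N" "ae_class m N (rep F) = F"
    unfolding f(2) by (rule rep_ae_class[OF f(1)], rule ae_class_cong[OF rep_ae_class(2)[OF f(1)]])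
qed

lemma rep_section_class:
  assumes "s \<in> sections m E"
  shows "rep (section_class m E s) \<in> sections m E" "AE x in m. rep (section_class m E s) x = s x"
proof -
  have "s \<in> section_class m E s" using assms by (simp add: section_class_def)
  then have "rep (section_class m E s) \<in> section_class m E s" by (rule rep_in)
  then show "rep (section_class m E s) \<in> sections m E" "AE x in m. rep (section_class m E s) x = s x"
    by (auto simp: section_class_def)
qed

lemma section_class_cong: "AE x in m. f x = g x \<Longrightarrow> section_class m E f = section_class m E g"
  unfolding section_class_def by (intro Collect_cong conj_cong refl AE_eq_cong)

section \<open>The abstract module read through representing sections of the bundle\<close>

locale sectioned_module = random_normed_module m M rnorm
  for m :: "'x measure" and M :: "(('x \<Rightarrow> real) set, 'v) module" and rnorm +
  fixes E :: "'x \<Rightarrow> 'u::{banach, second_countable_topology} set"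
    and \<Phi> :: "'v \<Rightarrow> ('x \<Rightarrow> 'u) set"
  assumes measurable_bundle: "measurable_banach_bundle m E"
    and iso: "rnm_iso m M rnorm (section_module m E) (section_norm m) \<Phi>"
begin

text \<open>Passing to actual functions makes pointwise arguments possible. The price is that the
  operations of \<open>M\<close> are respected only almost everywhere, with a null set depending on
  the elements involved.\<close>

definition R :: "'v \<Rightarrow> 'x \<Rightarrow> 'u" where
  "R v = rep (\<Phi> v)"

lemma abelian_group_M: "abelian_group M"
  using L0_module by (rule Module.module.axioms)

interpretation M: abelian_group M
  by (rule abelian_group_M)

interpretation prob_space m
  by (rule base)

lemma subspace_fibre: "x \<in> space m \<Longrightarrow> subspace (E x)"
  and closed_fibre: "x \<in> space m \<Longrightarrow> closed (E x)"
  using measurable_bundle by (auto simp: measurable_banach_bundle_def)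

lemma R_section_and_class:
  assumes "v \<in> carrier M"
  shows "R v \<in> sections m E" "\<Phi> v = section_class m E (R v)"
proof -
  have "\<Phi> v \<in> section_class m E ` sections m E"
    using iso assms unfolding rnm_iso_def section_module_def by (auto dest: bij_betwE)
  then obtain s where s: "s \<in> sections m E" "\<Phi> v = section_class m E s" by blast
  show "R v \<in> sections m E"
    unfolding R_def s(2) by (rule rep_section_class(1)[OF s(1)])
  show "\<Phi> v = section_class m E (R v)"
    unfolding R_def s(2) by (rule section_class_cong[OF rep_section_class(2)[OF s(1)], symmetric])
qed

lemma R_measurable: "v \<in> carrier M \<Longrightarrow> R v \<in> borel_measurable m"
  and R_fibre: "v \<in> carrier M \<Longrightarrow> x \<in> space m \<Longrightarrow> R v x \<in> E x"
  using R_section_and_class(1) by (auto simp: sections_def)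

lemma R_inject:
  assumes "v \<in> carrier M" "w \<in> carrier M" "AE x in m. R v x = R w x"
  shows "v = w"
proof -
  have "\<Phi> v = \<Phi> w" using assms by (simp add: R_section_and_class(2) section_class_cong)
  then show ?thesis
    using iso assms unfolding rnm_iso_def by (meson bij_betw_imp_inj_on inj_onD)
qed

lemma R_add:
  assumes "v \<in> carrier M" "w \<in> carrier M"
  shows "AE x in m. R (v \<oplus>\<^bsub>M\<^esub> w) x = R v x + R w x"
proof -
  have "\<Phi> (v \<oplus>\<^bsub>M\<^esub> w) = \<Phi> v \<oplus>\<^bsub>section_module m E\<^esub> \<Phi> w"
    using iso assms unfolding rnm_iso_def by blast
  then have "\<Phi> (v \<oplus>\<^bsub>M\<^esub> w) = section_class m E (\<lambda>x. R v x + R w x)"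
    by (simp add: section_module_def R_def)
  moreover have "(\<lambda>x. R v x + R w x) \<in> sections m E"
    using assms R_measurable[measurable] R_fibre
    by (auto simp: sections_def intro!: subspace_add subspace_fibre)
  ultimately show ?thesis using rep_section_class(2) by (simp add: R_def)
qed

text \<open>The isomorphism is required to preserve only sums, multiples and norms, so zero is
  identified as the solution of z = z + z in almost every fibre.\<close>

lemma R_zero: "AE x in m. R \<zero>\<^bsub>M\<^esub> x = 0"
proof -
  have "AE x in m. R \<zero>\<^bsub>M\<^esub> x = R \<zero>\<^bsub>M\<^esub> x + R \<zero>\<^bsub>M\<^esub> x"
    using R_add[of "\<zero>\<^bsub>M\<^esub>" "\<zero>\<^bsub>M\<^esub>"] by simp
  then show ?thesis by eventually_elim simp
qed

lemma R_minus:
  assumes "v \<in> carrier M" "w \<in> carrier M"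
  shows "AE x in m. R (v \<ominus>\<^bsub>M\<^esub> w) x = R v x - R w x"
proof -
  have "w \<oplus>\<^bsub>M\<^esub> (v \<ominus>\<^bsub>M\<^esub> w) = v"
    using assms M.minus_eq M.a_lcomm M.r_neg M.r_zero by simp
  with R_add[of w "v \<ominus>\<^bsub>M\<^esub> w"] assms have "AE x in m. R v x = R w x + R (v \<ominus>\<^bsub>M\<^esub> w) x" by simp
  then show ?thesis by eventually_elim simp
qed

lemma R_finsum:
  assumes "\<And>n::nat. f n \<in> carrier M"
  shows "AE x in m. R (\<Oplus>\<^bsub>M\<^esub>n\<in>{..<N}. f n) x = (\<Sum>n<N. R (f n) x)"
proof (induction N)
  case 0
  then show ?case using R_zero by simp
next
  case (Suc N)
  have "(\<Oplus>\<^bsub>M\<^esub>n\<in>{..<Suc N}. f n) = f N \<oplus>\<^bsub>M\<^esub> (\<Oplus>\<^bsub>M\<^esub>n\<in>{..<N}. f n)"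
    unfolding lessThan_Suc using assms by (intro M.finsum_insert) auto
  moreover have "AE x in m. R (f N \<oplus>\<^bsub>M\<^esub> (\<Oplus>\<^bsub>M\<^esub>n\<in>{..<N}. f n)) x = R (f N) x + R (\<Oplus>\<^bsub>M\<^esub>n\<in>{..<N}. f n) x"
    using assms by (intro R_add M.finsum_closed) auto
  ultimately have "AE x in m. R (\<Oplus>\<^bsub>M\<^esub>n\<in>{..<Suc N}. f n) x = R (f N) x + R (\<Oplus>\<^bsub>M\<^esub>n\<in>{..<N}. f n) x"
    by simp
  with Suc show ?case by eventually_elim simp
qed

lemma R_norm:
  assumes "v \<in> carrier M"
  shows "AE x in m. rep (rnorm v) x = norm (R v x)"
proof -
  have "rnorm v = ae_class m borel (\<lambda>x. norm (R v x))"
    using iso assms unfolding rnm_iso_def section_norm_def R_def by metis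
  moreover have "(\<lambda>x. norm (R v x)) \<in> borel_measurable m"
    using R_measurable[OF assms] by measurable
  ultimately show ?thesis using rep_ae_class(2) by metis
qed

lemma rnorm_measurable: "v \<in> carrier M \<Longrightarrow> rep (rnorm v) \<in> borel_measurable m"
  using rnorm_pos[of v] ae_class_rep(1)[of "rnorm v" m borel] by (simp add: L0_pos_def L0_def)

text \<open>The distance of \<open>M\<close> becomes the usual metric of convergence in probability
  for functions with values in \<open>'u\<close>.\<close>

lemma rdist_eq:
  assumes "v \<in> carrier M" "w \<in> carrier M"
  shows "rdist m M rnorm v w = (LINT x|m. min (norm (R v x - R w x)) 1)"
proof -
  have c: "v \<ominus>\<^bsub>M\<^esub> w \<in> carrier M" using assms by simp
  have [measurable]: "R v \<in> borel_measurable m" "R w \<in> borel_measurable m"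
    "rep (rnorm (v \<ominus>\<^bsub>M\<^esub> w)) \<in> borel_measurable m"
    using assms c by (simp_all only: R_measurable rnorm_measurable)
  have "AE x in m. min (rep (rnorm (v \<ominus>\<^bsub>M\<^esub> w)) x) 1 = min (norm (R v x - R w x)) 1"
    using R_norm[OF c] R_minus[OF assms] by eventually_elim simp
  then show ?thesis
    using assms unfolding rdist_def carrier_dist_def by (auto intro!: integral_cong_AE)
qed

lemma integrable_truncated_norm:
  fixes f :: "'x \<Rightarrow> 'u"
  assumes [measurable]: "f \<in> borel_measurable m"
  shows "integrable m (\<lambda>x. min (norm (f x)) 1)"
  by (rule integrable_const_bound[of _ 1]) auto

lemma integral_truncated_norm_eq_0:
  fixes f :: "'x \<Rightarrow> 'u"
  assumes "f \<in> borel_measurable m"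
  shows "(LINT x|m. min (norm (f x)) 1) = 0 \<longleftrightarrow> (AE x in m. f x = 0)"
proof -
  have "(LINT x|m. min (norm (f x)) 1) = 0 \<longleftrightarrow> (AE x in m. min (norm (f x)) 1 = 0)"
    by (rule integral_nonneg_eq_0_iff_AE[OF integrable_truncated_norm[OF assms]]) auto
  also have "\<dots> \<longleftrightarrow> (AE x in m. f x = 0)"
    by (rule arg_cong[where f = "\<lambda>P. almost_everywhere m P"]) (auto simp: min_def fun_eq_iff)
  finally show ?thesis .
qed

text \<open>The metric axioms are needed before \<open>limitin\<close> can be unfolded into
  distances. Definiteness rests on the injectivity of \<open>\<Phi>\<close>, the triangle inequality
  on the subadditivity of min(t, 1) for t \<ge> 0.\<close>

lemma Metric_space_rdist: "Metric_space (carrier M) (rdist m M rnorm)"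
proof
  fix v w
  show "0 \<le> rdist m M rnorm v w"
  proof (cases "v \<in> carrier M \<and> w \<in> carrier M")
    case True
    then show ?thesis by (simp add: rdist_eq)
  qed (auto simp: rdist_def carrier_dist_def)
  show "rdist m M rnorm v w = rdist m M rnorm w v"
  proof (cases "v \<in> carrier M \<and> w \<in> carrier M")
    case True
    then show ?thesis by (simp add: rdist_eq norm_minus_commute)
  qed (auto simp: rdist_def carrier_dist_def)
next
  fix v w assume vw: "v \<in> carrier M" "w \<in> carrier M"
  have "(\<lambda>x. R v x - R w x) \<in> borel_measurable m"
    using vw R_measurable[measurable] by measurable
  from integral_truncated_norm_eq_0[OF this] show "rdist m M rnorm v w = 0 \<longleftrightarrow> v = w"
    using vw R_inject by (auto simp: rdist_eq)
next
  fix u v w assume uvw: "u \<in> carrier M" "v \<in> carrier M" "w \<in> carrier M"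
  have [measurable]: "R u \<in> borel_measurable m" "R v \<in> borel_measurable m" "R w \<in> borel_measurable m"
    using uvw by (auto intro: R_measurable)
  have int: "integrable m (\<lambda>x. min (norm (f x - g x)) 1)"
    if "f \<in> borel_measurable m" "g \<in> borel_measurable m" for f g :: "'x \<Rightarrow> 'u"
    using that by (intro integrable_truncated_norm) measurable
  have "(LINT x|m. min (norm (R u x - R w x)) 1)
      \<le> (LINT x|m. min (norm (R u x - R v x)) 1 + min (norm (R v x - R w x)) 1)"
  proof (rule integral_mono)
    fix x
    have "norm (R u x - R w x) \<le> norm (R u x - R v x) + norm (R v x - R w x)"
      using norm_triangle_ineq[of "R u x - R v x" "R v x - R w x"] by simp
    then show "min (norm (R u x - R w x)) 1 \<le> min (norm (R u x - R v x)) 1 + min (norm (R v x - R w x)) 1"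
      using norm_ge_zero[of "R u x - R v x"] norm_ge_zero[of "R v x - R w x"] by linarith
  qed (auto intro!: int)
  also have "\<dots> = (LINT x|m. min (norm (R u x - R v x)) 1) + (LINT x|m. min (norm (R v x - R w x)) 1)"
    by (intro Bochner_Integration.integral_add int) auto
  finally show "rdist m M rnorm u w \<le> rdist m M rnorm u v + rdist m M rnorm v w"
    using uvw by (simp add: rdist_eq)
qed

text \<open>Bridges limits in \<open>M\<close> and almost everywhere limits of representatives: by
  dominated convergence the integral of min(|u - R v|, 1) is the limit of distances that tend to
  0.\<close>

lemma R_limit_unique:
  assumes lim: "limitin (rtopology m M rnorm) f v sequentially"
    and f: "\<And>n. f n \<in> carrier M"
    and u: "u \<in> borel_measurable m"
    and ae: "AE x in m. (\<lambda>n. R (f n) x) \<longlonglongrightarrow> u x"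
  shows "AE x in m. R v x = u x"
proof -
  interpret Metric_space "carrier M" "rdist m M rnorm" by (rule Metric_space_rdist)
  have v: "v \<in> carrier M" and d0: "(\<lambda>n. rdist m M rnorm (f n) v) \<longlonglongrightarrow> 0"
    using lim unfolding limitin_metric_dist_null by blast+
  have [measurable]: "R v \<in> borel_measurable m" "\<And>n. R (f n) \<in> borel_measurable m" "u \<in> borel_measurable m"
    using R_measurable v f u by auto
  have "(\<lambda>n. LINT x|m. min (norm (R (f n) x - R v x)) 1) \<longlonglongrightarrow> (LINT x|m. min (norm (u x - R v x)) 1)"
  proof (rule integral_dominated_convergence[where w = "\<lambda>_. 1"])
    show "AE x in m. (\<lambda>n. min (norm (R (f n) x - R v x)) 1) \<longlonglongrightarrow> min (norm (u x - R v x)) 1"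
      using ae by eventually_elim (intro tendsto_intros)
  qed auto
  with d0 have "(LINT x|m. min (norm (u x - R v x)) 1) = 0"
    using v f LIMSEQ_unique by (simp add: rdist_eq) blast
  then have "AE x in m. u x - R v x = 0"
    by (subst (asm) integral_truncated_norm_eq_0) auto
  then show ?thesis by eventually_elim simp
qed

end


section \<open>Essential suprema and the variation\<close>

text \<open>Exhaustion: the supremum of the measures of countable unions is attained by merging an
  approximating sequence of countable subfamilies, and adjoining one more member cannot increase
  it.\<close>

lemma (in finite_measure) countable_essential_union:
  assumes S: "\<S> \<subseteq> sets M"
  shows "\<exists>\<T>\<subseteq>\<S>. countable \<T> \<and> (\<forall>A\<in>\<S>. A - \<Union>\<T> \<in> null_sets M)"
proof -
  define C where "C = {\<T>. \<T> \<subseteq> \<S> \<and> countable \<T>}"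
  define c where "c = (SUP \<T>\<in>C. measure M (\<Union>\<T>))"
  have bdd: "bdd_above ((\<lambda>\<T>. measure M (\<Union>\<T>)) ` C)"
    by (rule bdd_aboveI[of _ "measure M (space M)"]) (auto simp: bounded_measure)
  have "{} \<in> C" by (simp add: C_def)
  have meas: "\<Union>\<T> \<in> sets M" if "\<T> \<in> C" for \<T>
    using that S unfolding C_def by (intro sets.countable_Union) auto
  have "\<exists>\<T>\<in>C. c - 1 / Suc n < measure M (\<Union>\<T>)" for n
    using less_cSUP_iff[of C "\<lambda>\<T>. measure M (\<Union>\<T>)" "c - 1 / Suc n"] bdd \<open>{} \<in> C\<close>
    unfolding c_def[symmetric] by auto
  then obtain T where T: "T n \<in> C" "c - 1 / Suc n < measure M (\<Union>(T n))" for n by metis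
  let ?T = "\<Union>n. T n"
  have TC: "?T \<in> C" using T(1) by (auto simp: C_def)
  have "c \<le> measure M (\<Union>?T) + e" if e: "e > 0" for e :: real
  proof -
    obtain n where "1 / Suc n < e" using nat_approx_posE[OF e] by blast
    moreover have "measure M (\<Union>(T n)) \<le> measure M (\<Union>?T)"
      using meas[OF TC] by (intro finite_measure_mono) auto
    ultimately show ?thesis using T(2)[of n] by linarith
  qed
  then have c: "c \<le> measure M (\<Union>?T)" by (rule field_le_epsilon)
  have "A - \<Union>?T \<in> null_sets M" if A: "A \<in> \<S>" for A
  proof -
    have "insert A ?T \<in> C" using TC A by (auto simp: C_def)
    then have "measure M (\<Union>(insert A ?T)) \<le> c" unfolding c_def by (rule cSUP_upper[OF _ bdd])
    moreover have "measure M (\<Union>(insert A ?T)) = measure M (\<Union>?T) + measure M (A - \<Union>?T)"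
      using finite_measure_Union[of "\<Union>?T" "A - \<Union>?T"] meas[OF TC] A S
      by (auto simp: Un_Diff_cancel Un_commute)
    ultimately have "measure M (A - \<Union>?T) = 0" using c measure_nonneg[of M "A - \<Union>?T"] by linarith
    then show ?thesis using meas[OF TC] A S by (auto simp: null_sets_def emeasure_eq_measure)
  qed
  with TC show ?thesis unfolding C_def by blast
qed

text \<open>Uses essential unions of the superlevel sets at each rational level. If
  \<open>s x\<close> exceeded the countable supremum, a rational strictly between them would put
  \<open>x\<close> into one of countably many null sets.\<close>

lemma (in finite_measure) countable_essential_supremum:
  fixes S :: "('a \<Rightarrow> ereal) set"
  assumes S: "S \<subseteq> borel_measurable M"
  shows "\<exists>S0\<subseteq>S. countable S0 \<and> (\<forall>s\<in>S. AE x in M. s x \<le> (SUP t\<in>S0. t x))"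
proof -
  define lev where "lev q s = {x \<in> space M. ereal (real_of_rat q) < s x}" for q and s :: "'a \<Rightarrow> ereal"
  have lev: "lev q s \<in> sets M" if "s \<in> S" for q s
  proof -
    have [measurable]: "s \<in> borel_measurable M" using that S by blast
    show ?thesis unfolding lev_def by measurable
  qed
  have "\<exists>T\<subseteq>S. countable T \<and> (\<forall>s\<in>S. lev q s - (\<Union>t\<in>T. lev q t) \<in> null_sets M)" for q
  proof -
    have "lev q ` S \<subseteq> sets M" using lev by blast
    from countable_essential_union[OF this] obtain \<T>
      where \<T>: "\<T> \<subseteq> lev q ` S" "countable \<T>" "\<forall>A\<in>lev q ` S. A - \<Union>\<T> \<in> null_sets M" by blast
    then obtain T where "countable T" "T \<subseteq> S" "\<T> = lev q ` T"
      using countable_subset_image[of \<T> "lev q" S] by auto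
    with \<T>(3) show ?thesis by auto
  qed
  then obtain T where T: "\<And>q. T q \<subseteq> S" "\<And>q. countable (T q)"
    "\<And>q s. s \<in> S \<Longrightarrow> lev q s - (\<Union>t\<in>T q. lev q t) \<in> null_sets M" by metis
  have "AE x in M. s x \<le> (SUP t\<in>(\<Union>q. T q). t x)" if s: "s \<in> S" for s
  proof -
    have "AE x in M. \<forall>q. x \<notin> lev q s - (\<Union>t\<in>T q. lev q t)"
      unfolding AE_all_countable using AE_not_in[OF T(3)[OF s]] by blast
    then show ?thesis
    proof (rule AE_mp, intro AE_I2 impI)
      fix x assume x: "x \<in> space M" and *: "\<forall>q. x \<notin> lev q s - (\<Union>t\<in>T q. lev q t)"
      show "s x \<le> (SUP t\<in>(\<Union>q. T q). t x)"
      proof (rule ccontr)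
        assume "\<not> ?thesis"
        then have "(SUP t\<in>(\<Union>q. T q). t x) < s x" by simp
        from ereal_dense3[OF this]
        obtain q where q: "(SUP t\<in>(\<Union>q. T q). t x) < ereal (real_of_rat q)" "ereal (real_of_rat q) < s x"
          by blast
        from this(2) obtain t where "t \<in> T q" "ereal (real_of_rat q) < t x" using * x by (auto simp: lev_def)
        then have "ereal (real_of_rat q) < (SUP t\<in>(\<Union>q. T q). t x)" by (auto simp: less_SUP_iff)
        with q(1) show False by simp
      qed
    qed
  qed
  with T(1,2) show ?thesis by (intro exI[of _ "\<Union>q. T q"]) auto
qed

text \<open>
  The supremum of a set of classes is a choice term, so nothing is known about it before a least
  upper bound has been found.
\<close>

lemma L0_bar_sup_least:
  assumes "prob_space m" and A: "A \<subseteq> carrier (L0_bar m)"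
  shows "least (L0_bar m) (\<Squnion>\<^bsub>L0_bar m\<^esub> A) (Upper (L0_bar m) A)"
proof -
  interpret prob_space m by fact
  have rep: "rep F \<in> borel_measurable m" if "F \<in> A" for F
    using A that ae_class_rep(1)[of F m borel] by (auto simp: L0_bar_def)
  then have "rep ` A \<subseteq> borel_measurable m" by blast
  from countable_essential_supremum[OF this] obtain S where S: "S \<subseteq> rep ` A" "countable S"
    "\<forall>s\<in>rep ` A. AE x in m. s x \<le> (SUP t\<in>S. t x)" by blast
  \<comment> \<open>Countability of \<open>S\<close> makes this pointwise supremum measurable; the
    supremum over all of \<open>rep\<close> would depend on uncountably many functions.\<close>
  define g where "g x = (SUP t\<in>S. t x)" for x
  have g: "g \<in> borel_measurable m"
    unfolding g_def using S(1,2) rep by (intro borel_measurable_SUP) auto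
  have "least (L0_bar m) (ae_class m borel g) (Upper (L0_bar m) A)"
    unfolding least_def
  proof (intro conjI ballI)
    show "Upper (L0_bar m) A \<subseteq> carrier (L0_bar m)" by (rule Upper_closed)
    show "ae_class m borel g \<in> Upper (L0_bar m) A"
      unfolding Upper_def
    proof (intro IntI CollectI allI impI)
      show "ae_class m borel g \<in> carrier (L0_bar m)" using g by (simp add: L0_bar_def)
      fix F assume "F \<in> A \<inter> carrier (L0_bar m)"
      with S(3) have "AE x in m. rep F x \<le> g x" by (auto simp: g_def)
      with rep_ae_class(2)[OF g] have "AE x in m. rep F x \<le> rep (ae_class m borel g) x"
        by eventually_elim simp
      then show "F \<sqsubseteq>\<^bsub>L0_bar m\<^esub> ae_class m borel g" by (simp add: L0_bar_def ae_le_def)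
    qed
  next
    fix U assume U: "U \<in> Upper (L0_bar m) A"
    have "AE x in m. s x \<le> rep U x" if "s \<in> S" for s
      using that S(1) U A unfolding Upper_def by (auto simp: L0_bar_def ae_le_def)
    then have "AE x in m. \<forall>s\<in>S. s x \<le> rep U x" using S(2) by (simp add: AE_ball_countable)
    with rep_ae_class(2)[OF g] have "AE x in m. rep (ae_class m borel g) x \<le> rep U x"
      by eventually_elim (simp add: g_def SUP_le_iff)
    then show "ae_class m borel g \<sqsubseteq>\<^bsub>L0_bar m\<^esub> U" by (simp add: L0_bar_def ae_le_def)
  qed
  then show ?thesis unfolding Lattice.sup_def by (rule someI)
qed

section \<open>The variation of a module-valued measure in terms of representatives\<close>

context sectioned_module
begin

context
  fixes \<Omega> :: "'o::metric_space set" and \<mu> :: "'o set \<Rightarrow> 'v"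
  assumes meas: "module_measure m M rnorm \<Omega> \<mu>"
begin

lemma measure_carrier: "A \<in> borel_sets \<Omega> \<Longrightarrow> \<mu> A \<in> carrier M"
  using meas by (simp add: module_measure_def)

lemma measure_empty: "\<mu> {} = \<zero>\<^bsub>M\<^esub>"
  using meas by (simp add: module_measure_def)

lemma borel_partitions_carrier: "P \<in> borel_partitions \<Omega> A \<Longrightarrow> \<mu> (P n) \<in> carrier M"
  by (rule measure_carrier) (auto simp: borel_partitions_def)

lemma rep_L0_suminf:
  assumes P: "P \<in> borel_partitions \<Omega> A"
  shows "L0_suminf m (\<lambda>n. rnorm (\<mu> (P n))) \<in> carrier (L0_bar m)"
    and "AE x in m. rep (L0_suminf m (\<lambda>n. rnorm (\<mu> (P n)))) x = (\<Sum>n. ereal (norm (R (\<mu> (P n)) x)))"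
proof -
  have [measurable]: "\<And>n. rep (rnorm (\<mu> (P n))) \<in> borel_measurable m"
    using borel_partitions_carrier[OF P] by (intro rnorm_measurable)
  have f: "(\<lambda>x. \<Sum>n. ereal (rep (rnorm (\<mu> (P n))) x)) \<in> borel_measurable m" by measurable
  then show "L0_suminf m (\<lambda>n. rnorm (\<mu> (P n))) \<in> carrier (L0_bar m)"
    unfolding L0_suminf_def by (simp add: L0_bar_def)
  have "AE x in m. \<forall>n. rep (rnorm (\<mu> (P n))) x = norm (R (\<mu> (P n)) x)"
    unfolding AE_all_countable using R_norm borel_partitions_carrier[OF P] by blast
  with rep_ae_class(2)[OF f]
  show "AE x in m. rep (L0_suminf m (\<lambda>n. rnorm (\<mu> (P n)))) x = (\<Sum>n. ereal (norm (R (\<mu> (P n)) x)))"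
    unfolding L0_suminf_def by eventually_elim simp
qed

lemma mvar_least_upper:
  "least (L0_bar m) (mvar m rnorm \<Omega> \<mu> A)
    (Upper (L0_bar m) {L0_suminf m (\<lambda>n. rnorm (\<mu> (P n))) | P. P \<in> borel_partitions \<Omega> A})"
  unfolding mvar_def by (rule L0_bar_sup_least[OF base]) (auto intro: rep_L0_suminf(1))

lemma mvar_in_carrier: "mvar m rnorm \<Omega> \<mu> A \<in> carrier (L0_bar m)"
  using mvar_least_upper[of A] unfolding least_def by blast

lemma real_of_mvar_measurable:
  "(\<lambda>x. real_of_ereal (rep (mvar m rnorm \<Omega> \<mu> A) x)) \<in> borel_measurable m"
proof -
  have "rep (mvar m rnorm \<Omega> \<mu> A) \<in> borel_measurable m"
    using mvar_in_carrier[of A] ae_class_rep(1)[of _ m borel] by (simp add: L0_bar_def)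
  then show ?thesis by measurable
qed

lemma rep_L0_mvar_in: "rep (L0_mvar m rnorm \<Omega> \<mu> A) \<in> L0_mvar m rnorm \<Omega> \<mu> A"
proof (rule rep_in)
  show "(\<lambda>x. real_of_ereal (rep (mvar m rnorm \<Omega> \<mu> A) x)) \<in> L0_mvar m rnorm \<Omega> \<mu> A"
    using real_of_mvar_measurable by (simp add: L0_mvar_def L0_of_bar_def ae_class_def)
qed

lemma suminf_le_mvar:
  assumes P: "P \<in> borel_partitions \<Omega> A"
  shows "AE x in m. (\<Sum>n. ereal (norm (R (\<mu> (P n)) x))) \<le> rep (mvar m rnorm \<Omega> \<mu> A) x"
proof -
  have "ae_le m (L0_suminf m (\<lambda>n. rnorm (\<mu> (P n)))) (mvar m rnorm \<Omega> \<mu> A)"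
    using mvar_least_upper[of A] rep_L0_suminf(1)[OF P] P unfolding least_def Upper_def
    by (auto simp: L0_bar_def)
  then have "AE x in m. rep (L0_suminf m (\<lambda>n. rnorm (\<mu> (P n)))) x \<le> rep (mvar m rnorm \<Omega> \<mu> A) x"
    by (simp add: ae_le_def)
  with rep_L0_suminf(2)[OF P] show ?thesis by eventually_elim simp
qed

text \<open>Prepending the complement turns a partition of \<open>A\<close> into one of
  \<open>\<Omega>\<close> whose sum is no smaller. The purpose is finiteness: for bounded variation,
  each value of \<open>mvar\<close> lies below an almost everywhere finite one.\<close>

lemma mvar_mono:
  assumes "A \<in> borel_sets \<Omega>"
  shows "AE x in m. rep (mvar m rnorm \<Omega> \<mu> A) x \<le> rep (mvar m rnorm \<Omega> \<mu> \<Omega>) x"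
proof -
  have "mvar m rnorm \<Omega> \<mu> \<Omega> \<in> Upper (L0_bar m) {L0_suminf m (\<lambda>n. rnorm (\<mu> (P n))) | P. P \<in> borel_partitions \<Omega> A}"
    unfolding Upper_def
  proof (intro IntI CollectI allI impI mvar_in_carrier)
    fix F assume "F \<in> {L0_suminf m (\<lambda>n. rnorm (\<mu> (P n))) | P. P \<in> borel_partitions \<Omega> A} \<inter> carrier (L0_bar m)"
    then obtain P where P: "P \<in> borel_partitions \<Omega> A" and F: "F = L0_suminf m (\<lambda>n. rnorm (\<mu> (P n)))" by blast
    have "\<Omega> \<in> borel_sets \<Omega>" using sets.top[of "restrict_space borel \<Omega>"] by (simp add: space_restrict_space)
    then have "\<Omega> - A \<in> borel_sets \<Omega>" using assms by (rule sets.Diff)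
    moreover have "A \<subseteq> \<Omega>" using sets.sets_into_space[OF assms] by (simp add: space_restrict_space)
    ultimately have Q: "case_nat (\<Omega> - A) P \<in> borel_partitions \<Omega> \<Omega>"
      using P \<open>\<Omega> - A \<in> borel_sets \<Omega>\<close> unfolding borel_partitions_def
    proof (intro CollectI conjI)
      assume P': "P \<in> {P. range P \<subseteq> borel_sets \<Omega> \<and> disjoint_family P \<and> (\<Union>n. P n) = A}"
      show "range (case_nat (\<Omega> - A) P) \<subseteq> borel_sets \<Omega>"
        using P' \<open>\<Omega> - A \<in> borel_sets \<Omega>\<close> by (auto split: nat.split)
      show "(\<Union>n. case_nat (\<Omega> - A) P n) = \<Omega>"
        using P' \<open>A \<subseteq> \<Omega>\<close> by (subst UNIV_nat_eq) auto
      show "disjoint_family (case_nat (\<Omega> - A) P)"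
        unfolding disjoint_family_on_def
      proof (intro ballI impI)
        fix i j :: nat assume "i \<noteq> j"
        then show "case_nat (\<Omega> - A) P i \<inter> case_nat (\<Omega> - A) P j = {}"
          using P' by (cases i; cases j) (auto simp: disjoint_family_on_def)
      qed
    qed
    have "AE x in m. rep F x \<le> rep (mvar m rnorm \<Omega> \<mu> \<Omega>) x"
      using rep_L0_suminf(2)[OF P] suminf_le_mvar[OF Q]
    proof eventually_elim
      case (elim x)
      let ?f = "\<lambda>n. ereal (norm (R (\<mu> (case_nat (\<Omega> - A) P n)) x))"
      have "(\<Sum>n. ?f (n + 1)) \<le> (\<Sum>n. ?f n)" by (rule suminf_ereal_offset_le) simp
      also note elim(2)
      finally show ?case unfolding F elim(1) by simp
    qed
    then show "F \<sqsubseteq>\<^bsub>L0_bar m\<^esub> mvar m rnorm \<Omega> \<mu> \<Omega>" by (simp add: L0_bar_def ae_le_def)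
  qed
  then have "mvar m rnorm \<Omega> \<mu> A \<sqsubseteq>\<^bsub>L0_bar m\<^esub> mvar m rnorm \<Omega> \<mu> \<Omega>"
    using mvar_least_upper[of A] unfolding least_def by blast
  then show ?thesis by (simp add: L0_bar_def ae_le_def)
qed

context
  assumes bv: "bounded_variation m rnorm \<Omega> \<mu>"
begin

lemma mvar_finite:
  obtains g :: "'x \<Rightarrow> real" where "AE x in m. rep (mvar m rnorm \<Omega> \<mu> \<Omega>) x = ereal (g x)"
proof -
  obtain G where G: "G \<in> carrier (L0 m)" "mvar m rnorm \<Omega> \<mu> \<Omega> = L0_to_bar m G"
    using bv by (auto simp: bounded_variation_def L0_pos_def)
  have "rep G \<in> borel_measurable m" using G(1) ae_class_rep(1)[of G m borel] by (simp add: L0_def)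
  then have "(\<lambda>x. ereal (rep G x)) \<in> borel_measurable m" by measurable
  from rep_ae_class(2)[OF this] show thesis
    using that unfolding G(2) L0_to_bar_def by blast
qed

lemma norm_le_L0_mvar:
  assumes A: "A \<in> borel_sets \<Omega>"
  shows "AE x in m. norm (R (\<mu> A) x) \<le> rep (L0_mvar m rnorm \<Omega> \<mu> A) x"
proof -
  obtain g where g: "AE x in m. rep (mvar m rnorm \<Omega> \<mu> \<Omega>) x = ereal (g x)" by (rule mvar_finite)
  have P: "(\<lambda>n. if n = 0 then A else {}) \<in> borel_partitions \<Omega> A"
    using A by (auto simp: borel_partitions_def disjoint_family_on_def split: if_splits)
  from rep_ae_class(2)[OF real_of_mvar_measurable]
  have "AE x in m. rep (L0_mvar m rnorm \<Omega> \<mu> A) x = real_of_ereal (rep (mvar m rnorm \<Omega> \<mu> A) x)"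
    by (simp add: L0_mvar_def L0_of_bar_def)
  \<comment> \<open>Finiteness of the variation matters: \<open>real_of_ereal\<close> sends \<open>\<infinity>\<close> to \<open>0\<close>.\<close>
  with g mvar_mono[OF A] suminf_le_mvar[OF P] show ?thesis
  proof eventually_elim
    case (elim x)
    let ?f = "\<lambda>n. ereal (norm (R (\<mu> (if n = 0 then A else {})) x))"
    \<comment> \<open>Only the term at 0 is kept. The others are nonnegative, so
      \<open>R (\<mu> {})\<close> need not be evaluated.\<close>
    have "?f 0 \<le> (\<Sum>n. ?f n)"
      using sum_le_suminf[of ?f "{0}"] by (simp add: summable_ereal_pos)
    with elim(3) have "ereal (norm (R (\<mu> A) x)) \<le> rep (mvar m rnorm \<Omega> \<mu> A) x" by simp
    with elim(1,2,4) show ?case by (cases "rep (mvar m rnorm \<Omega> \<mu> A) x") auto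
  qed
qed

text \<open>One real bound serves all partitions, and only the null set varies with \<open>P\<close>
  and \<open>I\<close>. The bound is a finite version of the variation of \<open>\<Omega>\<close>;
  its measurability is not claimed.\<close>

lemma sums_bounded_AE:
  obtains g :: "'x \<Rightarrow> real"
  where "\<And>P I. P \<in> borel_partitions \<Omega> \<Omega> \<Longrightarrow> finite I \<Longrightarrow> AE x in m. (\<Sum>n\<in>I. norm (R (\<mu> (P n)) x)) \<le> g x"
proof -
  obtain g where g: "AE x in m. rep (mvar m rnorm \<Omega> \<mu> \<Omega>) x = ereal (g x)" by (rule mvar_finite)
  have "AE x in m. (\<Sum>n\<in>I. norm (R (\<mu> (P n)) x)) \<le> g x"
    if P: "P \<in> borel_partitions \<Omega> \<Omega>" and I: "finite I" for P I
    using g suminf_le_mvar[OF P]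
  proof eventually_elim
    case (elim x)
    let ?f = "\<lambda>n. ereal (norm (R (\<mu> (P n)) x))"
    have "sum ?f I \<le> (\<Sum>n. ?f n)" using I by (intro sum_le_suminf) (auto simp: summable_ereal_pos)
    also note elim(2)
    finally show ?case unfolding elim(1) by simp
  qed
  then show thesis by (rule that)
qed

end
end
end


section \<open>Extension of dominated vector measures\<close>

definition vector_measure_on :: "'a set set \<Rightarrow> ('a set \<Rightarrow> 'b::real_normed_vector) \<Rightarrow> bool" where
  "vector_measure_on \<A> u \<longleftrightarrow> u {} = 0 \<and>
     (\<forall>A. range A \<subseteq> \<A> \<and> disjoint_family A \<longrightarrow> (\<lambda>n::nat. u (A n)) sums u (\<Union>n. A n))"

lemma vector_measure_onD:
  "vector_measure_on \<A> u \<Longrightarrow> range A \<subseteq> \<A> \<Longrightarrow> disjoint_family A \<Longrightarrow> (\<lambda>n::nat. u (A n)) sums u (\<Union>n. A n)"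
  by (simp add: vector_measure_on_def)

lemma vector_measure_on_Un:
  assumes u: "vector_measure_on \<A> u" and AB: "A \<in> \<A>" "B \<in> \<A>" "{} \<in> \<A>" "A \<inter> B = {}"
  shows "u (A \<union> B) = u A + u B"
proof -
  define C where "C n = (if n = 0 then A else if n = 1 then B else {})" for n :: nat
  have "(\<lambda>n. u (C n)) sums u (\<Union>n. C n)"
    using AB by (intro vector_measure_onD[OF u]) (auto simp: C_def disjoint_family_on_def)
  moreover have "(\<Union>n. C n) = A \<union> B" by (auto simp: C_def split: if_splits)
  moreover have "(\<lambda>n. u (C n)) sums (\<Sum>n\<in>{0, 1}. u (C n))"
    using u by (intro sums_finite) (auto simp: C_def vector_measure_on_def)
  ultimately show ?thesis using sums_unique2 by (fastforce simp: C_def)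
qed

text \<open>The sets of agreement are treated by the \<pi>-\<lambda> theorem;
  \<open>\<Omega> \<in> G\<close> provides the equal total values on which the complement case
  relies.\<close>

lemma vector_measure_on_eqI:
  assumes G: "Int_stable G" "G \<subseteq> Pow \<Omega>" "\<Omega> \<in> G"
    and u: "vector_measure_on (sigma_sets \<Omega> G) u" and w: "vector_measure_on (sigma_sets \<Omega> G) w"
    and eq: "\<And>A. A \<in> G \<Longrightarrow> u A = w A" and A: "A \<in> sigma_sets \<Omega> G"
  shows "u A = w A"
  using A
proof (induction rule: sigma_sets_induct_disjoint[OF G(1,2), consumes 1, case_names basic empty compl union])
  case (compl A)
  have *: "\<Omega> \<in> sigma_sets \<Omega> G" "\<Omega> - A \<in> sigma_sets \<Omega> G" "{} \<in> sigma_sets \<Omega> G"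
    using compl(1) by (auto intro: sigma_sets_top sigma_sets.Compl sigma_sets.Empty)
  have "A \<subseteq> \<Omega>" using sigma_sets_into_sp[OF G(2) compl(1)] .
  then have "A \<union> (\<Omega> - A) = \<Omega>" by blast
  then have "u \<Omega> = u A + u (\<Omega> - A)" "w \<Omega> = w A + w (\<Omega> - A)"
    using vector_measure_on_Un[OF u compl(1) *(2,3)] vector_measure_on_Un[OF w compl(1) *(2,3)] by auto
  with eq[OF G(3)] compl(2) show ?case by simp
next
  case (union A)
  have "(\<lambda>n. u (A n)) sums u (\<Union>n. A n)" "(\<lambda>n. w (A n)) sums w (\<Union>n. A n)"
    by (rule vector_measure_onD[OF u union(2,1)], rule vector_measure_onD[OF w union(2,1)])
  then show ?case unfolding union(3) using sums_unique2 by blast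
qed (use u w eq in \<open>auto simp: vector_measure_on_def\<close>)

text \<open>The sets approximable to every tolerance form a \<sigma>-algebra. For a union, a tail of
  small measure is discarded and the finitely many remaining sets are approximated.\<close>

lemma (in Sigma_Algebra.algebra) approximation_in_measure:
  assumes fin: "finite_measure \<tau>" and sets: "sets \<tau> = sigma_sets \<Omega> M"
    and B: "B \<in> sets \<tau>" and e: "0 < e"
  shows "\<exists>A\<in>M. measure \<tau> (sym_diff A B) < e"
proof -
  interpret \<tau>: finite_measure \<tau> by (rule fin)
  have M: "A \<in> sets \<tau>" if "A \<in> M" for A
    using that by (simp add: sets)
  have "B \<in> sigma_sets \<Omega> M" using B sets by simp
  then show ?thesis using e
  proof (induction arbitrary: e rule: sigma_sets.induct)
    case (Basic A)
    then show ?case by (intro bexI[of _ A]) auto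
  next
    case Empty
    then show ?case by (intro bexI[of _ "{}"]) auto
  next
    case (Compl B)
    then obtain A where A: "A \<in> M" "measure \<tau> (sym_diff A B) < e" by blast
    have "B \<subseteq> \<Omega>" "A \<subseteq> \<Omega>"
      using Compl(1) A(1) space_closed by (auto dest: sigma_sets_into_sp[OF space_closed])
    then have "sym_diff (\<Omega> - A) (\<Omega> - B) = sym_diff A B" by blast
    with A show ?case by (intro bexI[of _ "\<Omega> - A"]) auto
  next
    case (Union B)
    have B: "B i \<in> sets \<tau>" for i using Union(1) sets by simp
    have "(\<lambda>n. measure \<tau> (\<Union>i<n. B i)) \<longlonglongrightarrow> measure \<tau> (\<Union>n. \<Union>i<n. B i)"
      by (rule \<tau>.finite_Lim_measure_incseq) (use B in \<open>auto simp: incseq_def, meson lessThan_iff less_le_trans\<close>)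
    also have "(\<Union>n. \<Union>i<n. B i) = (\<Union>i. B i)" by blast
    finally have "\<forall>\<^sub>F n in sequentially. dist (measure \<tau> (\<Union>i<n. B i)) (measure \<tau> (\<Union>i. B i)) < e / 2"
      using Union(3) by (intro tendstoD) auto
    then obtain n where n: "dist (measure \<tau> (\<Union>i<n. B i)) (measure \<tau> (\<Union>i. B i)) < e / 2"
      by (meson eventually_happens trivial_limit_sequentially)
    \<comment> \<open>The n errors add up to at most e/2, the other half being spent on the tail; n
      + 1 makes sense of the quotient at n = 0 too.\<close>
    define \<delta> where "\<delta> = e / (2 * (real n + 1))"
    have \<delta>: "\<delta> > 0" using Union(3) by (simp add: \<delta>_def)
    have "\<forall>i. \<exists>A\<in>M. measure \<tau> (sym_diff A (B i)) < \<delta>" using Union(2) \<delta> by blast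
    then obtain A where A: "A i \<in> M" "measure \<tau> (sym_diff (A i) (B i)) < \<delta>" for i by metis
    let ?R = "(\<Union>i. B i) - (\<Union>i<n. B i)" and ?S = "\<Union>i<n. sym_diff (A i) (B i)"
    have AU: "(\<Union>i<n. A i) \<in> M" using A by (intro finite_UN) auto
    have "measure \<tau> (sym_diff (\<Union>i<n. A i) (\<Union>i. B i)) \<le> measure \<tau> (?R \<union> ?S)"
      using A B M by (intro \<tau>.finite_measure_mono) auto
    also have "\<dots> \<le> measure \<tau> ?R + measure \<tau> ?S"
      using A B M by (intro measure_Un_le) auto
    also have "measure \<tau> ?R = measure \<tau> (\<Union>i. B i) - measure \<tau> (\<Union>i<n. B i)"
      using B by (intro \<tau>.finite_measure_Diff) auto
    also have "\<dots> < e / 2" using n unfolding dist_real_def by linarith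
    also have "measure \<tau> ?S \<le> (\<Sum>i<n. measure \<tau> (sym_diff (A i) (B i)))"
      using A B M by (intro \<tau>.finite_measure_subadditive_finite) auto
    also have "\<dots> \<le> (\<Sum>i<n. \<delta>)" using A(2) by (intro sum_mono) (auto intro: less_imp_le)
    also have "\<dots> \<le> e / 2" using Union(3) by (simp add: \<delta>_def divide_simps)
    finally have "measure \<tau> (sym_diff (\<Union>i<n. A i) (\<Union>i. B i)) < e" by simp
    with AU show ?case by blast
  qed
qed

text \<open>Additivity and domination make \<open>v\<close> Lipschitz for the pseudometric given by
  the measure of the symmetric difference, in which \<open>M\<close> is dense, so \<open>v\<close>
  extends by completeness of \<open>'b\<close>. Countable additivity follows from domination of the
  tails. The domination clause later bounds variations, and the closure clause keeps values inside a
  closed fibre.\<close>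

lemma (in Sigma_Algebra.algebra) dominated_vector_measure_extension:
  fixes v :: "'a set \<Rightarrow> 'b::banach"
  assumes fin: "finite_measure \<tau>" and sets: "sets \<tau> = sigma_sets \<Omega> M"
    and add: "\<And>A B. A \<in> M \<Longrightarrow> B \<in> M \<Longrightarrow> A \<inter> B = {} \<Longrightarrow> v (A \<union> B) = v A + v B"
    and dom: "\<And>A. A \<in> M \<Longrightarrow> norm (v A) \<le> measure \<tau> A"
  shows "\<exists>u. (\<forall>A\<in>M. u A = v A) \<and>
    (\<forall>B\<in>sets \<tau>. norm (u B) \<le> measure \<tau> B \<and> u B \<in> closure (v ` M)) \<and>
    vector_measure_on (sets \<tau>) u"
proof -
  interpret \<tau>: finite_measure \<tau> by (rule fin)
  have M: "A \<in> sets \<tau>" if "A \<in> M" for A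
    using that by (simp add: sets)
  \<comment> \<open>The common part of \<open>A\<close> and \<open>B\<close> cancels, leaving the
    two halves of the symmetric difference.\<close>
  have lip: "norm (v A - v B) \<le> measure \<tau> (sym_diff A B)" if AB: "A \<in> M" "B \<in> M" for A B
  proof -
    have "v A = v (A - B) + v (A \<inter> B)" "v B = v (B - A) + v (A \<inter> B)"
      using AB add[of "A - B" "A \<inter> B"] add[of "B - A" "A \<inter> B"]
      by (auto simp: Un_Diff_Int Int_commute[of B A] Un_Diff_Int[of B A, unfolded Int_commute[of B A]])
    then have "norm (v A - v B) \<le> norm (v (A - B)) + norm (v (B - A))"
      by (metis add_diff_cancel_right norm_triangle_ineq4)
    also have "\<dots> \<le> measure \<tau> (A - B) + measure \<tau> (B - A)"
      using AB by (intro add_mono dom) auto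
    also have "\<dots> = measure \<tau> (sym_diff A B)"
      using AB M by (intro \<tau>.finite_measure_Union[symmetric]) auto
    finally show ?thesis .
  qed
  define appr where "appr = (\<lambda>A B. (\<forall>n::nat. A n \<in> M) \<and> (\<lambda>n. measure \<tau> (sym_diff (A n) B)) \<longlonglongrightarrow> 0)"
  have ex: "\<exists>A. appr A B" if "B \<in> sets \<tau>" for B
  proof -
    have "\<forall>n::nat. \<exists>A\<in>M. measure \<tau> (sym_diff A B) < 1 / real (Suc n)"
      using approximation_in_measure[OF fin sets that] by simp
    then obtain A where A: "A n \<in> M" "measure \<tau> (sym_diff (A n) B) < 1 / real (Suc n)" for n by metis
    have "(\<lambda>n. measure \<tau> (sym_diff (A n) B)) \<longlonglongrightarrow> 0"
      using A(2) by (intro tendsto_sandwich[OF _ _ tendsto_const lim_1_over_n[THEN LIMSEQ_Suc]])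
        (auto intro!: always_eventually less_imp_le simp del: of_nat_Suc)
    with A show ?thesis unfolding appr_def by blast
  qed
  define \<alpha> where "\<alpha> B = (SOME A. appr A B)" for B
  have \<alpha>: "appr (\<alpha> B) B" if "B \<in> sets \<tau>" for B
    unfolding \<alpha>_def using ex[OF that] by (rule someI_ex)
  have mt: "measure \<tau> (sym_diff A A') \<le> measure \<tau> (sym_diff A B) + measure \<tau> (sym_diff A' B)"
    if "A \<in> sets \<tau>" "A' \<in> sets \<tau>" "B \<in> sets \<tau>" for A A' B
    using that by (intro order_trans[OF \<tau>.finite_measure_mono measure_Un_le]) auto
  define u where "u B = lim (\<lambda>n. v (\<alpha> B n))" for B
  have conv: "(\<lambda>n. v (\<alpha> B n)) \<longlonglongrightarrow> u B" if B: "B \<in> sets \<tau>" for B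
  proof -
    have a: "\<alpha> B n \<in> M" "(\<lambda>n. measure \<tau> (sym_diff (\<alpha> B n) B)) \<longlonglongrightarrow> 0" for n
      using \<alpha>[OF B] by (auto simp: appr_def)
    have "Cauchy (\<lambda>n. v (\<alpha> B n))"
    proof (rule metric_CauchyI)
      fix e :: real assume "e > 0"
      then have "\<forall>\<^sub>F n in sequentially. measure \<tau> (sym_diff (\<alpha> B n) B) < e / 2"
        using a(2) by (intro order_tendstoD) auto
      then obtain N where N: "\<And>n. n \<ge> N \<Longrightarrow> measure \<tau> (sym_diff (\<alpha> B n) B) < e / 2"
        by (auto simp: eventually_sequentially)
      have "dist (v (\<alpha> B m)) (v (\<alpha> B n)) < e" if "m \<ge> N" "n \<ge> N" for m n
        using lip[of "\<alpha> B m" "\<alpha> B n"] mt[of "\<alpha> B m" "\<alpha> B n" B] N[OF that(1)] N[OF that(2)] a(1) M B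
        unfolding dist_norm by fastforce
      then show "\<exists>N. \<forall>m\<ge>N. \<forall>n\<ge>N. dist (v (\<alpha> B m)) (v (\<alpha> B n)) < e" by blast
    qed
    then show ?thesis
      unfolding u_def by (simp add: Cauchy_convergent_iff convergent_LIMSEQ_iff)
  qed
  \<comment> \<open>Independence of the chosen sequence: constant sequences give agreement with
    \<open>v\<close> on \<open>M\<close>, and unions of approximants give additivity.\<close>
  have u_lim: "(\<lambda>n. v (A n)) \<longlonglongrightarrow> u B" if B: "B \<in> sets \<tau>" and A: "appr A B" for A B
  proof -
    have "(\<lambda>n. v (A n) - v (\<alpha> B n)) \<longlonglongrightarrow> 0"
    proof (rule Lim_null_comparison)
      show "\<forall>\<^sub>F n in sequentially. norm (v (A n) - v (\<alpha> B n))
          \<le> measure \<tau> (sym_diff (A n) B) + measure \<tau> (sym_diff (\<alpha> B n) B)"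
        using lip mt A \<alpha>[OF B] B M unfolding appr_def
        by (intro always_eventually allI) (meson order_trans)
      show "(\<lambda>n. measure \<tau> (sym_diff (A n) B) + measure \<tau> (sym_diff (\<alpha> B n) B)) \<longlonglongrightarrow> 0"
        using A \<alpha>[OF B] unfolding appr_def by (auto intro: tendsto_eq_intros)
    qed
    from tendsto_add[OF this conv[OF B]] show ?thesis by simp
  qed
  have u_dom: "norm (u B) \<le> measure \<tau> B" if B: "B \<in> sets \<tau>" for B
  proof (rule tendsto_le[OF _ _ tendsto_norm[OF conv[OF B]]])
    have a: "\<alpha> B n \<in> M" "(\<lambda>n. measure \<tau> (sym_diff (\<alpha> B n) B)) \<longlonglongrightarrow> 0" for n
      using \<alpha>[OF B] by (auto simp: appr_def)
    have "measure \<tau> (\<alpha> B n) \<le> measure \<tau> B + measure \<tau> (sym_diff (\<alpha> B n) B)" for n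
      using a B M by (intro order_trans[OF \<tau>.finite_measure_mono measure_Un_le]) auto
    then show "\<forall>\<^sub>F n in sequentially. norm (v (\<alpha> B n)) \<le> measure \<tau> B + measure \<tau> (sym_diff (\<alpha> B n) B)"
      using dom a(1) by (intro always_eventually allI) (meson order_trans)
    show "(\<lambda>n. measure \<tau> B + measure \<tau> (sym_diff (\<alpha> B n) B)) \<longlonglongrightarrow> measure \<tau> B"
      using a(2) by (auto intro: tendsto_eq_intros)
  qed simp
  have u_v: "u A = v A" if "A \<in> M" for A
  proof -
    have "appr (\<lambda>_. A) A" using that by (simp add: appr_def)
    from u_lim[OF M[OF that] this] show ?thesis by (simp add: LIMSEQ_const_iff)
  qed
  have v0: "v {} = 0" using dom[of "{}"] by simp
  have u_add: "u (B \<union> C) = u B + u C" if BC: "B \<in> sets \<tau>" "C \<in> sets \<tau>" "B \<inter> C = {}" for B C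
  proof -
    have a: "\<alpha> B n \<in> M" "(\<lambda>n. measure \<tau> (sym_diff (\<alpha> B n) B)) \<longlonglongrightarrow> 0"
      "\<alpha> C n \<in> M" "(\<lambda>n. measure \<tau> (sym_diff (\<alpha> C n) C)) \<longlonglongrightarrow> 0" for n
      using \<alpha>[OF BC(1)] \<alpha>[OF BC(2)] by (auto simp: appr_def)
    let ?s = "\<lambda>n. measure \<tau> (sym_diff (\<alpha> B n) B) + measure \<tau> (sym_diff (\<alpha> C n) C)"
    have s0: "?s \<longlonglongrightarrow> 0" using a by (auto intro: tendsto_eq_intros)
    have sub: "measure \<tau> D \<le> ?s n"
      if "D \<subseteq> sym_diff (\<alpha> B n) B \<union> sym_diff (\<alpha> C n) C" for n D
      using a BC M that by (intro order_trans[OF \<tau>.finite_measure_mono[OF that] measure_Un_le]) auto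
    have "appr (\<lambda>n. \<alpha> B n \<union> \<alpha> C n) (B \<union> C)"
      unfolding appr_def using a
      by (auto intro!: tendsto_sandwich[OF _ _ tendsto_const s0] always_eventually sub)
    then have 1: "(\<lambda>n. v (\<alpha> B n \<union> \<alpha> C n)) \<longlonglongrightarrow> u (B \<union> C)"
      using BC by (intro u_lim) auto
    \<comment> \<open>Approximants of disjoint sets may overlap, but a point of the overlap lies
      outside \<open>B\<close> or outside \<open>C\<close>, hence in one of the symmetric
      differences.\<close>
    have i0: "(\<lambda>n. v (\<alpha> B n \<inter> \<alpha> C n)) \<longlonglongrightarrow> 0"
    proof (rule Lim_null_comparison[OF _ s0], intro always_eventually allI)
      show "norm (v (\<alpha> B n \<inter> \<alpha> C n)) \<le> ?s n" for n
        using a BC(3) by (intro order_trans[OF dom sub]) auto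
    qed
    have "v (\<alpha> B n \<union> \<alpha> C n) = v (\<alpha> B n) + v (\<alpha> C n) - v (\<alpha> B n \<inter> \<alpha> C n)" for n
    proof -
      have "v (\<alpha> B n \<union> (\<alpha> C n - \<alpha> B n)) = v (\<alpha> B n) + v (\<alpha> C n - \<alpha> B n)"
        "v ((\<alpha> B n \<inter> \<alpha> C n) \<union> (\<alpha> C n - \<alpha> B n)) = v (\<alpha> B n \<inter> \<alpha> C n) + v (\<alpha> C n - \<alpha> B n)"
        by (rule add; use a in blast)+
      moreover have "(\<alpha> B n \<inter> \<alpha> C n) \<union> (\<alpha> C n - \<alpha> B n) = \<alpha> C n" by blast
      ultimately show ?thesis by simp
    qed
    moreover have "(\<lambda>n. v (\<alpha> B n) + v (\<alpha> C n) - v (\<alpha> B n \<inter> \<alpha> C n)) \<longlonglongrightarrow> u B + u C - 0"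
      using BC by (intro tendsto_intros conv i0)
    ultimately show ?thesis using 1 LIMSEQ_unique by fastforce
  qed
  have u0: "u {} = 0" using u_v[of "{}"] v0 by simp
  have u_sums: "(\<lambda>n::nat. u (A n)) sums u (\<Union>n. A n)"
    if A: "range A \<subseteq> sets \<tau>" "disjoint_family A" for A
  proof -
    have fin_sum: "(\<Sum>n<N. u (A n)) = u (\<Union>n<N. A n)" for N
    proof (induction N)
      case (Suc N)
      have "u ((\<Union>n<N. A n) \<union> A N) = u (\<Union>n<N. A n) + u (A N)"
        using A by (intro u_add) (auto simp: disjoint_family_on_def, metis disjoint_iff less_irrefl)
      with Suc show ?case by (simp add: lessThan_Suc Un_commute)
    qed (simp add: u0)
    let ?T = "\<lambda>N. (\<Union>n. A n) - (\<Union>n<N. A n)"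
    have dec: "u (\<Union>n. A n) = u (\<Union>n<N. A n) + u (?T N)" for N
    proof -
      have "(\<Union>n<N. A n) \<union> ?T N = (\<Union>n. A n)" by blast
      then show ?thesis using A u_add[of "\<Union>n<N. A n" "?T N"] by auto
    qed
    have dec': "u (\<Union>n<N. A n) = u (\<Union>n. A n) - u (?T N)" for N
      using dec[of N] by simp
    have "(\<lambda>N. measure \<tau> (?T N)) \<longlonglongrightarrow> measure \<tau> (\<Inter>N. ?T N)"
      using A by (intro \<tau>.finite_Lim_measure_decseq) (auto simp: decseq_def)
    also have "(\<Inter>N. ?T N) = {}" by blast
    finally have lim: "(\<lambda>N. measure \<tau> (?T N)) \<longlonglongrightarrow> 0" by simp
    have "\<forall>\<^sub>F N in sequentially. norm (u (?T N)) \<le> measure \<tau> (?T N)"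
      using A by (intro always_eventually allI u_dom) auto
    from Lim_null_comparison[OF this lim] have "(\<lambda>N. u (?T N)) \<longlonglongrightarrow> 0" .
    from tendsto_diff[OF tendsto_const[of "u (\<Union>n. A n)"] this]
    show ?thesis unfolding sums_def fin_sum dec' by simp
  qed
  have "u B \<in> closure (v ` M)" if B: "B \<in> sets \<tau>" for B
    using conv[OF B] \<alpha>[OF B] unfolding appr_def closure_sequential
    by (intro exI[of _ "\<lambda>n. v (\<alpha> B n)"]) auto
  with u_v u_dom u0 u_sums show ?thesis unfolding vector_measure_on_def by blast
qed


section \<open>Vector measures on the Cantor space\<close>

definition determined :: "nat \<Rightarrow> (nat \<Rightarrow> bool) set \<Rightarrow> bool" where
  "determined n A \<longleftrightarrow> (\<forall>f g. (\<forall>i<n. f i = g i) \<longrightarrow> f \<in> A \<longleftrightarrow> g \<in> A)"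

text \<open>By compactness these are exactly the clopen sets of the product topology.\<close>

definition cylinders :: "(nat \<Rightarrow> bool) set set" where
  "cylinders = {A. \<exists>n. determined n A}"

text \<open>For \<open>F \<subseteq> {..<n}\<close> these are the 2^n atoms of the algebra of sets
  determined by the leading n bits.\<close>

definition cell :: "nat \<Rightarrow> nat set \<Rightarrow> (nat \<Rightarrow> bool) set" where
  "cell n F = {f. \<forall>i<n. f i \<longleftrightarrow> i \<in> F}"

definition cantor :: "(nat \<Rightarrow> bool) measure" where
  "cantor = sigma UNIV cylinders"

lemma space_cantor [simp]: "space cantor = UNIV"
  and sets_cantor: "sets cantor = sigma_sets UNIV cylinders"
  by (simp_all add: cantor_def)

lemma determinedD: "determined n A \<Longrightarrow> (\<And>i. i < n \<Longrightarrow> f i = g i) \<Longrightarrow> f \<in> A \<longleftrightarrow> g \<in> A"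
  by (auto simp: determined_def)

lemma determined_mono: "determined n A \<Longrightarrow> n \<le> k \<Longrightarrow> determined k A"
  by (simp add: determined_def)

lemma algebra_cylinders: "Sigma_Algebra.algebra UNIV cylinders"
  unfolding algebra_iff_Un
proof (intro conjI ballI)
  show "{} \<in> cylinders" by (simp add: cylinders_def determined_def)
next
  fix A assume "A \<in> cylinders"
  then obtain n where "determined n A" by (auto simp: cylinders_def)
  then have "determined n (UNIV - A)" by (simp add: determined_def)
  then show "UNIV - A \<in> cylinders" by (auto simp: cylinders_def)
next
  fix A B assume "A \<in> cylinders" "B \<in> cylinders"
  then obtain n k where "determined n A" "determined k B" by (auto simp: cylinders_def)
  then have "determined (max n k) A" "determined (max n k) B"
    by (auto intro: determined_mono)
  then have "determined (max n k) (A \<union> B)"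
    by (simp add: determined_def) blast
  then show "A \<union> B \<in> cylinders" by (auto simp: cylinders_def)
qed simp

interpretation cylinders: Sigma_Algebra.algebra UNIV cylinders
  by (rule algebra_cylinders)

lemma cell_in_cylinders: "cell n F \<in> cylinders"
  by (auto simp: cylinders_def determined_def cell_def intro!: exI[of _ n])

lemma determined_cell_subset_or_disjoint:
  assumes "determined n A"
  shows "cell n F \<subseteq> A \<or> A \<inter> cell n F = {}"
proof -
  have "f \<in> A \<longleftrightarrow> g \<in> A" if "f \<in> cell n F" "g \<in> cell n F" for f g
    using that by (intro determinedD[OF assms]) (simp add: cell_def)
  then show ?thesis by blast
qed

lemma determined_eq_Union_cells:
  assumes "determined k A"
  shows "A = (\<Union>F\<in>{F. F \<subseteq> {..<k} \<and> cell k F \<subseteq> A}. cell k F)"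
proof -
  have "f \<in> (\<Union>F\<in>{F. F \<subseteq> {..<k} \<and> cell k F \<subseteq> A}. cell k F)" if "f \<in> A" for f
  proof (rule UN_I)
    show f: "f \<in> cell k {i. i < k \<and> f i}" by (simp add: cell_def)
    then show "{i. i < k \<and> f i} \<in> {F. F \<subseteq> {..<k} \<and> cell k F \<subseteq> A}"
      using determined_cell_subset_or_disjoint[OF assms, of "{i. i < k \<and> f i}"] that by auto
  qed
  then show ?thesis by blast
qed

text \<open>A cylinder of level k is coded by a set of subsets of \<open>{..<k}\<close>, so each
  level has finitely many. This is what allows one null set for all cylinders.\<close>

lemma countable_cylinders: "countable cylinders"
proof -
  have "cylinders \<subseteq> (\<Union>k. (\<lambda>S. \<Union>F\<in>S. cell k F) ` Pow (Pow {..<k}))"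
  proof
    fix A assume "A \<in> cylinders"
    then obtain n where "determined n A" by (auto simp: cylinders_def)
    show "A \<in> (\<Union>k. (\<lambda>S. \<Union>F\<in>S. cell k F) ` Pow (Pow {..<k}))"
      by (intro UN_I[of n] image_eqI[of _ _ "{F. F \<subseteq> {..<n} \<and> cell n F \<subseteq> A}"] determined_eq_Union_cells)
        (use \<open>determined n A\<close> in auto)
  qed
  then show ?thesis
    by (rule countable_subset) (intro countable_UN countableI_type countable_finite finite_imageI, simp)
qed

lemma closed_cylinder:
  assumes "A \<in> cylinders"
  shows "closed A"
proof -
  have op: "open B" if B: "B \<in> cylinders" for B
  proof (subst open_subopen, intro ballI)
    fix f assume f: "f \<in> B"
    obtain n where n: "determined n B" using B by (auto simp: cylinders_def)
    have "open ((\<lambda>g::nat \<Rightarrow> bool. g i) -` {f i})" for i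
      by (intro open_vimage Topological_Spaces.open_discrete continuous_on_product_coordinates)
    then have "open (\<Inter>i\<in>{..<n}. (\<lambda>g::nat \<Rightarrow> bool. g i) -` {f i})" by (intro open_INT) auto
    moreover have "(\<Inter>i\<in>{..<n}. (\<lambda>g. g i) -` {f i}) \<subseteq> B" using determinedD[OF n, of f] f by auto
    ultimately show "\<exists>T. open T \<and> f \<in> T \<and> T \<subseteq> B"
      by (intro exI[of _ "\<Inter>i\<in>{..<n}. (\<lambda>g. g i) -` {f i}"]) auto
  qed
  have "UNIV - A \<in> cylinders" using assms by blast
  from op[OF this] show ?thesis by (simp add: closed_def Compl_eq_Diff_UNIV)
qed

lemma compact_cantor_space: "compact (UNIV :: (nat \<Rightarrow> bool) set)"
proof -
  have "compact (UNIV :: bool set)" by (intro finite_imp_compact) simp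
  then have "compact_space (product_topology (\<lambda>_::nat. euclidean :: bool topology) UNIV)"
    by (simp add: compact_space_product_topology) (simp add: compact_space_def)
  then show ?thesis
    by (simp add: compact_space_def euclidean_product_topology flip: compactin_euclidean_iff)
qed

text \<open>Nested closed sets in a compact space. Continuity at the empty set, the delicate
  hypothesis of Caratheodory's theorem, thus concerns only sequences that are eventually
  empty.\<close>

lemma cylinders_decseq_empty:
  assumes A: "range A \<subseteq> cylinders" "decseq A" and empty: "(\<Inter>i::nat. A i) = {}"
  shows "\<exists>i. A i = {}"
proof (rule ccontr)
  assume ne: "\<nexists>i. A i = {}"
  have "UNIV \<inter> (\<Inter>i\<in>UNIV. A i) \<noteq> {}"
  proof (rule compact_imp_fip_image[OF compact_cantor_space])
    show "closed (A i)" for i using A by (intro closed_cylinder) auto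
    fix I :: "nat set" assume "finite I"
    \<comment> \<open>Inserting 0 covers the case of empty \<open>I\<close>, where
      \<open>Max\<close> is unspecified.\<close>
    then have "A (Max (insert 0 I)) \<subseteq> (\<Inter>i\<in>I. A i)"
      using A(2) by (intro INT_greatest) (auto simp: decseq_def)
    with ne show "UNIV \<inter> (\<Inter>i\<in>I. A i) \<noteq> {}" by auto
  qed
  with empty show False by simp
qed

text \<open>Mirrors the splitting of \<open>cell n F\<close> by the value of bit
  \<open>n\<close>.\<close>

lemma sum_Pow_lessThan_Suc:
  fixes h :: "nat set \<Rightarrow> 'a::comm_monoid_add"
  shows "(\<Sum>F\<in>Pow {..<Suc n}. h F) = (\<Sum>F\<in>Pow {..<n}. h F + h (insert n F))"
proof -
  have "inj_on (insert n) (Pow {..<n})" by (rule inj_onI) (auto simp: insert_ident)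
  moreover have "Pow {..<n} \<inter> insert n ` Pow {..<n} = {}" by auto
  ultimately show ?thesis
    by (simp add: lessThan_Suc Pow_insert sum.union_disjoint sum.reindex sum.distrib)
qed

text \<open>The measure is the variation of \<open>v\<close>, computed along the partitions into
  cells. By the triangle inequality these sums grow with the level, so a limit replaces the supremum
  over all partitions.\<close>

lemma cantor_control_measure:
  fixes v :: "(nat \<Rightarrow> bool) set \<Rightarrow> 'b::real_normed_vector"
  assumes add: "\<And>A B. A \<in> cylinders \<Longrightarrow> B \<in> cylinders \<Longrightarrow> A \<inter> B = {} \<Longrightarrow> v (A \<union> B) = v A + v B"
    and bound: "\<And>n. (\<Sum>F\<in>Pow {..<n}. norm (v (cell n F))) \<le> c"
  obtains \<tau> where "finite_measure \<tau>" "sets \<tau> = sets cantor"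
    "\<And>A. A \<in> cylinders \<Longrightarrow> norm (v A) \<le> measure \<tau> A"
proof -
  have v0: "v {} = 0" using add[of "{}" "{}"] by simp
  define a where "a n A = (\<Sum>F\<in>Pow {..<n}. norm (v (A \<inter> cell n F)))" for n A
  have cyl: "A \<inter> cell n F \<in> cylinders" if "A \<in> cylinders" for A n F
    using that cell_in_cylinders by blast
  have mono_Suc: "a n A \<le> a (Suc n) A" if A: "A \<in> cylinders" for n A
    unfolding a_def sum_Pow_lessThan_Suc
  proof (rule sum_mono)
    fix F assume F: "F \<in> Pow {..<n}"
    have "A \<inter> cell n F = (A \<inter> cell (Suc n) F) \<union> (A \<inter> cell (Suc n) (insert n F))"
      "(A \<inter> cell (Suc n) F) \<inter> (A \<inter> cell (Suc n) (insert n F)) = {}"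
      using F by (auto simp: cell_def less_Suc_eq)
    then have "v (A \<inter> cell n F) = v (A \<inter> cell (Suc n) F) + v (A \<inter> cell (Suc n) (insert n F))"
      using add[OF cyl[OF A] cyl[OF A]] by metis
    then show "norm (v (A \<inter> cell n F))
        \<le> norm (v (A \<inter> cell (Suc n) F)) + norm (v (A \<inter> cell (Suc n) (insert n F)))"
      by (simp add: norm_triangle_ineq)
  qed
  have mono: "incseq (\<lambda>n. a n A)" if "A \<in> cylinders" for A
    using mono_Suc[OF that] by (intro incseq_SucI)
  have le_c: "a n A \<le> c" if A: "A \<in> cylinders" for n A
  proof -
    obtain k where k: "determined k A" using A by (auto simp: cylinders_def)
    \<comment> \<open>The level is raised until it resolves \<open>A\<close>: each cell then lies in
      \<open>A\<close> or misses it, and the sum becomes part of the bounded one.\<close>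
    have "a n A \<le> a (max n k) A" using mono[OF A] by (simp add: incseq_def)
    also have "\<dots> \<le> (\<Sum>F\<in>Pow {..<max n k}. norm (v (cell (max n k) F)))"
      unfolding a_def
    proof (rule sum_mono)
      fix F
      show "norm (v (A \<inter> cell (max n k) F)) \<le> norm (v (cell (max n k) F))"
        using determined_cell_subset_or_disjoint[OF determined_mono[OF k], of "max n k" F] by (auto simp: v0 Int_absorb1)
    qed
    also have "\<dots> \<le> c" by (rule bound)
    finally show ?thesis .
  qed
  define t where "t A = lim (\<lambda>n. a n A)" for A
  have t_lim: "(\<lambda>n. a n A) \<longlonglongrightarrow> t A" if A: "A \<in> cylinders" for A
  proof -
    obtain L where "(\<lambda>n. a n A) \<longlonglongrightarrow> L"
      using incseq_convergent[OF mono[OF A]] le_c[OF A] by metis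
    then show ?thesis unfolding t_def by (metis limI)
  qed
  have a_le_t: "a n A \<le> t A" if "A \<in> cylinders" for n A
    using incseq_le[OF mono[OF that] t_lim[OF that]] .
  have a_nn: "0 \<le> a n A" for n A by (simp add: a_def sum_nonneg)
  have t_nn: "0 \<le> t A" if "A \<in> cylinders" for A
    using a_nn a_le_t[OF that] order_trans by blast
  have t_add: "t (A \<union> B) = t A + t B" if AB: "A \<in> cylinders" "B \<in> cylinders" "A \<inter> B = {}" for A B
  proof -
    obtain k where k: "determined k A" using AB(1) by (auto simp: cylinders_def)
    \<comment> \<open>A level resolving \<open>A\<close> alone suffices: a cell inside
      \<open>A\<close> misses \<open>B\<close> by disjointness.\<close>
    have "a n (A \<union> B) = a n A + a n B" if "k \<le> n" for n
      unfolding a_def sum.distrib[symmetric]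
    proof (rule sum.cong[OF refl])
      fix F
      from determined_cell_subset_or_disjoint[OF determined_mono[OF k that], of F] show "norm (v ((A \<union> B) \<inter> cell n F)) = norm (v (A \<inter> cell n F)) + norm (v (B \<inter> cell n F))"
      proof
        assume "cell n F \<subseteq> A"
        then have "B \<inter> cell n F = {}" "(A \<union> B) \<inter> cell n F = A \<inter> cell n F" using AB(3) by auto
        then show ?thesis by (simp add: v0)
      qed (simp add: v0 Int_Un_distrib2)
    qed
    then have "\<forall>\<^sub>F n in sequentially. a n A + a n B = a n (A \<union> B)"
      by (auto simp: eventually_sequentially intro!: exI[of _ k])
    then have "(\<lambda>n. a n (A \<union> B)) \<longlonglongrightarrow> t A + t B"
      using tendsto_add[OF t_lim[OF AB(1)] t_lim[OF AB(2)]] Lim_transform_eventually by fast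
    with t_lim[of "A \<union> B"] AB LIMSEQ_unique show ?thesis by blast
  qed
  have t0: "t {} = 0" using t_add[of "{}" "{}"] by simp
  have "\<exists>\<nu>. (\<forall>A\<in>cylinders. \<nu> A = ennreal (t A)) \<and> measure_space UNIV (sigma_sets UNIV cylinders) \<nu>"
  proof (rule cylinders.caratheodory_empty_continuous)
    show "positive cylinders (\<lambda>A. ennreal (t A))" by (simp add: positive_def t0)
    show "additive cylinders (\<lambda>A. ennreal (t A))"
      unfolding additive_def using t_add t_nn by simp
    fix A :: "nat \<Rightarrow> (nat \<Rightarrow> bool) set"
    assume A: "range A \<subseteq> cylinders" "decseq A" "(\<Inter>i. A i) = {}"
    then obtain i where i: "A i = {}" using cylinders_decseq_empty by blast
    have "A j = {}" if "i \<le> j" for j using A(2) i that by (auto simp: decseq_def)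
    then have "\<forall>\<^sub>F j in sequentially. ennreal (t (A j)) = 0"
      by (auto simp: eventually_sequentially t0 intro!: exI[of _ i])
    then show "(\<lambda>j. ennreal (t (A j))) \<longlonglongrightarrow> 0" by (rule tendsto_eventually)
  qed simp
  then obtain \<nu> where \<nu>: "\<And>A. A \<in> cylinders \<Longrightarrow> \<nu> A = ennreal (t A)"
    and ms: "measure_space UNIV (sigma_sets UNIV cylinders) \<nu>" by blast
  define \<tau> where "\<tau> = measure_of UNIV (sigma_sets UNIV cylinders) \<nu>"
  have sets: "sets \<tau> = sets cantor"
    by (simp add: \<tau>_def sets_cantor sigma_sets_sigma_sets_eq)
  have em: "emeasure \<tau> A = ennreal (t A)" if "A \<in> cylinders" for A
    using ms that \<nu>[OF that] unfolding \<tau>_def measure_space_def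
    by (subst emeasure_measure_of_sigma) auto
  have "space \<tau> = UNIV" by (simp add: \<tau>_def)
  then have "finite_measure \<tau>"
    by (intro finite_measureI) (simp add: em)
  moreover have "norm (v A) \<le> measure \<tau> A" if "A \<in> cylinders" for A
  proof -
    \<comment> \<open>The only cell of level 0 is the whole space.\<close>
    have "norm (v A) = a 0 A" by (simp add: a_def cell_def)
    also have "\<dots> \<le> t A" by (rule a_le_t[OF that])
    finally show ?thesis using em[OF that] t_nn[OF that] by (simp add: measure_def)
  qed
  ultimately show thesis using that sets by blast
qed

lemma cantor_vector_measure:
  fixes v :: "(nat \<Rightarrow> bool) set \<Rightarrow> 'b::banach"
  assumes add: "\<And>A B. A \<in> cylinders \<Longrightarrow> B \<in> cylinders \<Longrightarrow> A \<inter> B = {} \<Longrightarrow> v (A \<union> B) = v A + v B"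
    and bound: "\<And>n. (\<Sum>F\<in>Pow {..<n}. norm (v (cell n F))) \<le> c"
  shows "\<exists>u \<tau>. finite_measure \<tau> \<and> sets \<tau> = sets cantor \<and> (\<forall>A\<in>cylinders. u A = v A) \<and>
    (\<forall>B\<in>sets cantor. norm (u B) \<le> measure \<tau> B \<and> u B \<in> closure (v ` cylinders)) \<and>
    vector_measure_on (sets cantor) u"
proof -
  obtain \<tau> where \<tau>: "finite_measure \<tau>" "sets \<tau> = sets cantor"
    "\<And>A. A \<in> cylinders \<Longrightarrow> norm (v A) \<le> measure \<tau> A"
    using cantor_control_measure[of v c, OF add bound] by blast
  have "\<exists>u. (\<forall>A\<in>cylinders. u A = v A) \<and>
      (\<forall>B\<in>sets \<tau>. norm (u B) \<le> measure \<tau> B \<and> u B \<in> closure (v ` cylinders)) \<and>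
      vector_measure_on (sets \<tau>) u"
    by (rule cylinders.dominated_vector_measure_extension) (use \<tau> add in \<open>auto simp: sets_cantor\<close>)
  with \<tau>(1) show ?thesis unfolding \<tau>(2)[symmetric] by blast
qed


section \<open>Compact metric spaces as retracts of the Cantor space\<close>

lemma measurable_cantor_coordinate [measurable]: "Measurable.pred cantor (\<lambda>f. f i)"
proof -
  have "determined (Suc i) {f. f i}" by (auto simp: determined_def)
  then have "{f. f i} \<in> sets cantor" by (auto simp: sets_cantor cylinders_def)
  then show ?thesis by (simp add: pred_def)
qed

text \<open>Each cylinder is a finite union of cells, and membership in a cell tests finitely many
  bits.\<close>

lemma measurable_into_cantor:
  assumes [measurable]: "\<And>i. Measurable.pred N (\<lambda>\<omega>. f \<omega> i)"
  shows "f \<in> measurable N cantor"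
  unfolding cantor_def
proof (rule measurable_measure_of)
  fix A assume "A \<in> cylinders"
  then obtain n where "determined n A" by (auto simp: cylinders_def)
  define I where "I = {F. F \<subseteq> {..<n} \<and> cell n F \<subseteq> A}"
  have "A = (\<Union>F\<in>I. cell n F)"
    unfolding I_def using \<open>determined n A\<close> by (rule determined_eq_Union_cells)
  then have "f -` A \<inter> space N = (\<Union>F\<in>I. {\<omega> \<in> space N. \<forall>i<n. f \<omega> i \<longleftrightarrow> i \<in> F})"
    by (auto simp: cell_def)
  also have "\<dots> \<in> sets N"
  proof (rule sets.finite_UN)
    show "finite I" by (rule finite_subset[of _ "Pow {..<n}"]) (auto simp: I_def)
  qed measurable
  finally show "f -` A \<inter> space N \<in> sets N" .
qed auto

lemma compact_imp_countable_dense: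
  fixes \<Omega> :: "'o::metric_space set"
  assumes "compact \<Omega>" "\<Omega> \<noteq> {}"
  obtains D :: "nat \<Rightarrow> 'o" where "range D \<subseteq> \<Omega>" "\<And>\<omega> e. \<omega> \<in> \<Omega> \<Longrightarrow> 0 < e \<Longrightarrow> \<exists>i. dist (D i) \<omega> < e"
proof -
  have "\<exists>k. finite k \<and> k \<subseteq> \<Omega> \<and> \<Omega> \<subseteq> (\<Union>x\<in>k. ball x (1 / Suc n))" for n
    using seq_compact_imp_totally_bounded[OF compact_imp_seq_compact[OF assms(1)]] by simp
  then obtain K where K: "finite (K n)" "K n \<subseteq> \<Omega>" "\<Omega> \<subseteq> (\<Union>x\<in>K n. ball x (1 / Suc n))" for n
    by metis
  define C where "C = (\<Union>n. K n)"
  have C: "countable C" unfolding C_def using K(1) by (intro countable_UN) (auto intro: countable_finite)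
  have "C \<noteq> {}" using assms(2) K(3)[of 0] by (auto simp: C_def)
  with C have r: "range (from_nat_into C) = C" by (intro range_from_nat_into)
  show thesis
  proof
    show "range (from_nat_into C) \<subseteq> \<Omega>" unfolding r using K(2) by (auto simp: C_def)
    fix \<omega> and e :: real assume "\<omega> \<in> \<Omega>" "0 < e"
    then obtain n where "1 / Suc n < e" using nat_approx_posE by blast
    moreover obtain x where "x \<in> K n" "dist x \<omega> < 1 / Suc n"
      using K(3)[of n] \<open>\<omega> \<in> \<Omega>\<close> by auto
    moreover obtain i where "from_nat_into C i = x"
      using \<open>x \<in> K n\<close> r by (metis C_def UN_I UNIV_I imageE)
    ultimately show "\<exists>i. dist (from_nat_into C i) \<omega> < e" by (intro exI[of _ i]) simp
  qed
qed

text \<open>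
  The bits of \<open>\<phi> \<omega>\<close> record which balls \<open>ball (D i) (2\<^sup>-\<^sup>k)\<close> contain \<open>\<omega>\<close>; the centres of the first
  such balls for \<open>k = 0, 1, \<dots>\<close> converge to \<open>\<omega>\<close>, and \<open>\<psi>\<close> is their limit.
\<close>

lemma compact_borel_retract_of_cantor:
  fixes \<Omega> :: "'o::metric_space set"
  assumes "compact \<Omega>"
  obtains \<phi> :: "'o \<Rightarrow> nat \<Rightarrow> bool" and \<psi>
  where "\<phi> \<in> measurable (restrict_space borel \<Omega>) cantor" "\<psi> \<in> borel_measurable cantor"
    "\<And>\<omega>. \<omega> \<in> \<Omega> \<Longrightarrow> \<psi> (\<phi> \<omega>) = \<omega>"
proof (cases "\<Omega> = {}")
  case True
  then show thesis
    using that[of "\<lambda>_ _. False" "\<lambda>_. undefined"] by (auto intro!: measurable_into_cantor)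
next
  case False
  obtain D :: "nat \<Rightarrow> 'o" where D: "range D \<subseteq> \<Omega>"
    and dense: "\<And>\<omega> e. \<omega> \<in> \<Omega> \<Longrightarrow> 0 < e \<Longrightarrow> \<exists>i. dist (D i) \<omega> < e"
    using compact_imp_countable_dense[OF assms False] by blast
  define \<phi> where "\<phi> \<omega> j = (dist (D (fst (prod_decode j))) \<omega> < (1/2) ^ snd (prod_decode j))" for \<omega> j
  define N where "N k f = (LEAST i. f (prod_encode (i, k)))" for k and f :: "nat \<Rightarrow> bool"
  \<comment> \<open>Strings outside the range of \<open>\<phi>\<close> may name no ball, or
    unrelated ones. The factor 2 is what strings in the range satisfy: going through \<omega> costs
    (1/2)^k + (1/2)^l with l \<ge> k.\<close>
  define good where "good f \<longleftrightarrow> (\<forall>k l. k \<le> l \<longrightarrow> dist (D (N k f)) (D (N l f)) \<le> 2 * (1/2) ^ k)" for f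
  \<comment> \<open>The constant default makes the sequence converge at every string, so
    \<open>\<psi>\<close> is measurable as an everywhere pointwise limit.\<close>
  define \<xi> where "\<xi> k f = (if good f then D (N k f) else D 0)" for k f
  have \<phi>: "\<phi> \<in> measurable (restrict_space borel \<Omega>) cantor"
  proof (rule measurable_into_cantor)
    fix j
    have "open (ball (D (fst (prod_decode j))) ((1/2) ^ snd (prod_decode j)))" by simp
    then have "ball (D (fst (prod_decode j))) ((1/2) ^ snd (prod_decode j)) \<inter> \<Omega> \<in> borel_sets \<Omega>"
      by (auto simp: sets_restrict_space)
    moreover have "{\<omega> \<in> space (restrict_space borel \<Omega>). \<phi> \<omega> j} =
        ball (D (fst (prod_decode j))) ((1/2) ^ snd (prod_decode j)) \<inter> \<Omega>"
      by (auto simp: \<phi>_def space_restrict_space)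
    ultimately show "Measurable.pred (restrict_space borel \<Omega>) (\<lambda>\<omega>. \<phi> \<omega> j)"
      by (simp add: pred_def)
  qed
  have [measurable]: "N k \<in> measurable cantor (count_space UNIV)" for k
    unfolding N_def by measurable
  \<comment> \<open>Splitting by the countably many values of \<open>N k\<close> and
    \<open>N l\<close> avoids any joint measurability of \<open>dist\<close> on \<open>'o\<close>, a
    type that need not be separable.\<close>
  have "Measurable.pred cantor (\<lambda>f. \<exists>i j. N k f = i \<and> N l f = j \<and> dist (D i) (D j) \<le> 2 * (1/2) ^ k)" for k l
    by measurable
  then have [measurable]: "Measurable.pred cantor (\<lambda>f. dist (D (N k f)) (D (N l f)) \<le> 2 * (1/2) ^ k)" for k l
    by simp
  have [measurable]: "Measurable.pred cantor good"
    unfolding good_def by measurable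
  have \<xi>_meas: "\<xi> k \<in> borel_measurable cantor" for k
  proof -
    have [measurable]: "(\<lambda>f. D (N k f)) \<in> borel_measurable cantor"
      by (rule measurable_compose[of "N k" _ "count_space UNIV"]) auto
    show ?thesis unfolding \<xi>_def by measurable
  qed
  have \<xi>_conv: "\<exists>x. (\<lambda>k. \<xi> k f) \<longlonglongrightarrow> x" for f
  proof (cases "good f")
    case True
    have "Cauchy (\<lambda>k. \<xi> k f)"
    proof (rule metric_CauchyI)
      fix e :: real assume "e > 0"
      then obtain n where n: "(1/2) ^ n < e / 2" using real_arch_pow_inv[of "e/2" "1/2"] by auto
      have b: "dist (\<xi> k f) (\<xi> l f) < e" if "n \<le> k" "k \<le> l" for k l
      proof -
        have "dist (\<xi> k f) (\<xi> l f) \<le> 2 * (1/2) ^ k" using True that by (auto simp: \<xi>_def good_def)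
        also have "(1/2::real) ^ k \<le> (1/2) ^ n" using that by (intro power_decreasing) auto
        finally show ?thesis using n by simp
      qed
      have "dist (\<xi> k f) (\<xi> l f) < e" if "n \<le> k" "n \<le> l" for k l
        using b[of k l] b[of l k] that by (cases "k \<le> l") (auto simp: dist_commute)
      then show "\<exists>n. \<forall>k\<ge>n. \<forall>l\<ge>n. dist (\<xi> k f) (\<xi> l f) < e" by blast
    qed
    moreover have "\<xi> k f \<in> \<Omega>" for k using D by (auto simp: \<xi>_def)
    ultimately show ?thesis
      using compact_imp_complete[OF assms] unfolding complete_def by meson
  qed (auto simp: \<xi>_def intro!: exI[of _ "D 0"])
  define \<psi> where "\<psi> f = lim (\<lambda>k. \<xi> k f)" for f
  have \<psi>_lim: "(\<lambda>k. \<xi> k f) \<longlonglongrightarrow> \<psi> f" for f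
    using \<xi>_conv[of f] unfolding \<psi>_def by (metis limI)
  have "\<psi> (\<phi> \<omega>) = \<omega>" if \<omega>: "\<omega> \<in> \<Omega>" for \<omega>
  proof -
    have near: "dist (D (N k (\<phi> \<omega>))) \<omega> < (1/2) ^ k" for k
    proof -
      have "\<exists>i. \<phi> \<omega> (prod_encode (i, k))" using dense[OF \<omega>, of "(1/2) ^ k"] by (simp add: \<phi>_def)
      from LeastI_ex[OF this] show ?thesis by (simp add: N_def \<phi>_def)
    qed
    have "good (\<phi> \<omega>)"
      unfolding good_def
    proof (intro allI impI)
      fix k l :: nat assume "k \<le> l"
      then have "(1/2::real) ^ l \<le> (1/2) ^ k" by (intro power_decreasing) auto
      then show "dist (D (N k (\<phi> \<omega>))) (D (N l (\<phi> \<omega>))) \<le> 2 * (1/2) ^ k"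
        using near[of k] near[of l] dist_triangle2[of "D (N k (\<phi> \<omega>))" "D (N l (\<phi> \<omega>))" \<omega>] by linarith
    qed
    then have eq: "\<xi> k (\<phi> \<omega>) = D (N k (\<phi> \<omega>))" for k by (simp add: \<xi>_def)
    have "(\<lambda>k. dist (D (N k (\<phi> \<omega>))) \<omega>) \<longlonglongrightarrow> 0"
      by (rule tendsto_sandwich[OF _ _ tendsto_const LIMSEQ_power_zero[of "1/2::real"]])
        (auto intro!: always_eventually less_imp_le near)
    then have "(\<lambda>k. \<xi> k (\<phi> \<omega>)) \<longlonglongrightarrow> \<omega>" unfolding eq by (rule tendsto_dist_iff[THEN iffD2])
    with \<psi>_lim[of "\<phi> \<omega>"] show ?thesis using LIMSEQ_unique by blast
  qed
  moreover have "\<psi> \<in> borel_measurable cantor"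
    using \<xi>_meas \<psi>_lim by (rule borel_measurable_LIMSEQ_metric)
  ultimately show thesis using that \<phi> by blast
qed


section \<open>Foliations\<close>

lemma Int_stable_cylinders: "Int_stable cylinders"
  by (auto simp: Int_stable_def)

text \<open>A measure already adds up over disjoint pieces. The map \<open>h\<close> lets
  \<open>\<kappa>\<close> live on another space: it is the preimage under \<open>\<psi>\<close> for
  measures on the Cantor space, and the identity for the foliation of |\<mu>|.\<close>

lemma total_variation_le_emeasure:
  assumes h: "\<And>B. B \<in> borel_sets \<Omega> \<Longrightarrow> h B \<in> sets \<kappa>" "\<And>B C. B \<inter> C = {} \<Longrightarrow> h B \<inter> h C = {}"
      "\<And>P :: nat \<Rightarrow> _. (\<Union>n. h (P n)) = h (\<Union>n. P n)"
    and le: "\<And>B. B \<in> borel_sets \<Omega> \<Longrightarrow> ennreal (norm (\<nu> B)) \<le> emeasure \<kappa> (h B)"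
  shows "total_variation \<Omega> \<nu> A \<le> emeasure \<kappa> (h A)"
  unfolding total_variation_def
proof (rule SUP_least)
  fix P assume "P \<in> borel_partitions \<Omega> A"
  then have P: "\<And>n. P n \<in> borel_sets \<Omega>" "disjoint_family P" "(\<Union>n. P n) = A"
    by (auto simp: borel_partitions_def)
  have "(\<Sum>n. ennreal (norm (\<nu> (P n)))) \<le> (\<Sum>n. emeasure \<kappa> (h (P n)))"
    using le P(1) by (intro suminf_le) auto
  also have "\<dots> = emeasure \<kappa> (\<Union>n. h (P n))"
    using P(1,2) h(1,2) by (intro suminf_emeasure) (auto simp: disjoint_family_on_def)
  also have "\<dots> = emeasure \<kappa> (h A)" by (simp add: h(3) P(3))
  finally show "(\<Sum>n. ennreal (norm (\<nu> (P n)))) \<le> emeasure \<kappa> (h A)" .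
qed

context sectioned_module
begin

interpretation M: abelian_group M
  by (rule abelian_group_M)

interpretation prob_space m
  by (rule base)

context
  fixes \<Omega> :: "'o::metric_space set" and \<mu> :: "'o set \<Rightarrow> 'v"
  assumes meas: "module_measure m M rnorm \<Omega> \<mu>"
begin

text \<open>Countable additivity in \<open>M\<close> is used in this form: an almost everywhere sum
  of representatives represents the value on the union.\<close>

lemma R_measure_Union:
  assumes A: "range A \<subseteq> borel_sets \<Omega>" "disjoint_family A"
    and u: "u \<in> borel_measurable m" "AE x in m. (\<lambda>n. R (\<mu> (A n)) x) sums u x"
  shows "AE x in m. R (\<mu> (\<Union>n. A n)) x = u x"
proof (rule R_limit_unique[OF _ _ u(1)])
  have c: "\<mu> (A n) \<in> carrier M" for n using A(1) by (intro measure_carrier[OF meas]) auto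
  show "limitin (rtopology m M rnorm) (\<lambda>N. \<Oplus>\<^bsub>M\<^esub>n\<in>{..<N}. \<mu> (A n)) (\<mu> (\<Union>n. A n)) sequentially"
    using meas A unfolding module_measure_def by blast
  show "(\<Oplus>\<^bsub>M\<^esub>n\<in>{..<N}. \<mu> (A n)) \<in> carrier M" for N using c by (intro M.finsum_closed) auto
  have "AE x in m. \<forall>N. R (\<Oplus>\<^bsub>M\<^esub>n\<in>{..<N}. \<mu> (A n)) x = (\<Sum>n<N. R (\<mu> (A n)) x)"
    unfolding AE_all_countable using R_finsum[of "\<lambda>n. \<mu> (A n)"] c by blast
  with u(2) show "AE x in m. (\<lambda>N. R (\<Oplus>\<^bsub>M\<^esub>n\<in>{..<N}. \<mu> (A n)) x) \<longlonglongrightarrow> u x"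
    by eventually_elim (simp add: sums_def)
qed

lemma R_measure_empty: "AE x in m. R (\<mu> {}) x = 0"
  using R_zero measure_empty[OF meas] by simp

lemma R_measure_Un:
  assumes AB: "A \<in> borel_sets \<Omega>" "B \<in> borel_sets \<Omega>" "A \<inter> B = {}"
  shows "AE x in m. R (\<mu> (A \<union> B)) x = R (\<mu> A) x + R (\<mu> B) x"
proof -
  define C where "C n = (if n = 0 then A else if n = 1 then B else {})" for n :: nat
  have [measurable]: "R (\<mu> A) \<in> borel_measurable m" "R (\<mu> B) \<in> borel_measurable m"
    using AB by (auto intro: R_measurable measure_carrier[OF meas])
  have "AE x in m. R (\<mu> (\<Union>n. C n)) x = R (\<mu> A) x + R (\<mu> B) x"
  proof (rule R_measure_Union)
    show "AE x in m. (\<lambda>n. R (\<mu> (C n)) x) sums (R (\<mu> A) x + R (\<mu> B) x)"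
      using R_measure_empty
    proof eventually_elim
      case (elim x)
      have "(\<lambda>n. R (\<mu> (C n)) x) sums (\<Sum>n\<in>{0, 1}. R (\<mu> (C n)) x)"
        by (rule sums_finite) (auto simp: C_def elim)
      then show ?case by (simp add: C_def)
    qed
  qed (use AB in \<open>auto simp: C_def disjoint_family_on_def\<close>)
  moreover have "(\<Union>n. C n) = A \<union> B" by (auto simp: C_def split: if_splits)
  ultimately show ?thesis by simp
qed

section \<open>Transport between the compact space and the Cantor space\<close>

context
  fixes \<phi> :: "'o \<Rightarrow> nat \<Rightarrow> bool" and \<psi> :: "(nat \<Rightarrow> bool) \<Rightarrow> 'o"
  assumes compact: "compact \<Omega>"
    and bv: "bounded_variation m rnorm \<Omega> \<mu>"
    and \<phi>: "\<phi> \<in> measurable (restrict_space borel \<Omega>) cantor"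
    and \<psi>: "\<psi> \<in> borel_measurable cantor"
    and \<psi>\<phi>: "\<And>\<omega>. \<omega> \<in> \<Omega> \<Longrightarrow> \<psi> (\<phi> \<omega>) = \<omega>"
begin

text \<open>The set function \<open>\<mu> (pull C)\<close> is the image of \<open>\<mu>\<close>
  under \<open>\<phi>\<close>; the intersection is there because \<open>\<phi>\<close> is total on
  the type \<open>'o\<close>.\<close>

abbreviation "pull C \<equiv> \<phi> -` C \<inter> \<Omega>"

lemma pull_sets: "C \<in> sets cantor \<Longrightarrow> pull C \<in> borel_sets \<Omega>"
  using measurable_sets[OF \<phi>, of C] by (simp add: space_restrict_space)

lemma cylinders_sets: "C \<in> cylinders \<Longrightarrow> C \<in> sets cantor"
  by (simp add: sets_cantor)

text \<open>Compactness makes \<open>\<Omega>\<close> closed, so its relative Borel sets are Borel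
  in the whole type. As every one of them is a \<open>pull\<close>, the image of
  \<open>\<mu>\<close> loses no information.\<close>

lemma code_sets:
  assumes A: "A \<in> borel_sets \<Omega>"
  shows "\<psi> -` A \<in> sets cantor" "pull (\<psi> -` A) = A"
proof -
  have "A \<in> sets borel"
    using A compact_imp_closed[OF compact] by (auto simp: sets_restrict_space)
  from measurable_sets[OF \<psi> this] show "\<psi> -` A \<in> sets cantor" by simp
  have "A \<subseteq> \<Omega>" using A by (auto simp: sets_restrict_space)
  then show "pull (\<psi> -` A) = A" using \<psi>\<phi> by force
qed

text \<open>The cells of one level pull back to a partition of \<open>\<Omega>\<close>, so the same
  \<open>g\<close> bounds every level.\<close>

lemma R_pull_cell_sum_bounded:
  assumes g: "\<And>P I. P \<in> borel_partitions \<Omega> \<Omega> \<Longrightarrow> finite I \<Longrightarrow> AE x in m. (\<Sum>n\<in>I. norm (R (\<mu> (P n)) x)) \<le> g x"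
  shows "AE x in m. (\<Sum>F\<in>Pow {..<n}. norm (R (\<mu> (pull (cell n F))) x)) \<le> g x"
proof -
  \<comment> \<open>Partitions are indexed by all naturals; the cells of level \<open>n\<close> sit at the codes of subsets of \<open>{..<n}\<close>.\<close>
  define P where "P k = (if set_decode k \<subseteq> {..<n} then pull (cell n (set_decode k)) else {})" for k
  let ?I = "set_encode ` Pow {..<n}"
  have P: "P \<in> borel_partitions \<Omega> \<Omega>"
    unfolding borel_partitions_def
  proof (intro CollectI conjI)
    show "range P \<subseteq> borel_sets \<Omega>"
      using pull_sets[OF cylinders_sets[OF cell_in_cylinders]] by (auto simp: P_def)
    show "disjoint_family P"
      unfolding disjoint_family_on_def
    proof (intro ballI impI)
      fix i j :: nat assume "i \<noteq> j"
      then have ne: "set_decode i \<noteq> set_decode j" by (metis set_decode_inverse)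
      have "cell n (set_decode i) \<inter> cell n (set_decode j) = {}"
        if "set_decode i \<subseteq> {..<n}" "set_decode j \<subseteq> {..<n}"
      proof -
        obtain k where k: "k \<in> set_decode i \<longleftrightarrow> k \<notin> set_decode j" using ne by blast
        then have "k < n" using that by blast
        with k show ?thesis by (auto simp: cell_def)
      qed
      then show "P i \<inter> P j = {}" by (auto simp: P_def)
    qed
    have "\<omega> \<in> (\<Union>k. P k)" if "\<omega> \<in> \<Omega>" for \<omega>
    proof -
      let ?F = "{i. i < n \<and> \<phi> \<omega> i}"
      have "finite ?F" by simp
      then have "\<omega> \<in> P (set_encode ?F)" using that by (auto simp: P_def cell_def)
      then show ?thesis by blast
    qed
    then show "(\<Union>k. P k) = \<Omega>" by (auto simp: P_def split: if_splits)
  qed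
  have inj: "inj_on set_encode (Pow {..<n})"
    by (rule inj_on_subset[OF inj_on_set_encode]) (auto intro: finite_subset)
  have "(\<Sum>k\<in>?I. norm (R (\<mu> (P k)) x)) = (\<Sum>F\<in>Pow {..<n}. norm (R (\<mu> (pull (cell n F))) x))" for x
    unfolding sum.reindex[OF inj]
  proof (rule sum.cong[OF refl])
    fix F assume "F \<in> Pow {..<n}"
    then have "F \<subseteq> {..<n}" "finite F" by (auto intro: finite_subset)
    then show "((\<lambda>k. norm (R (\<mu> (P k)) x)) \<circ> set_encode) F = norm (R (\<mu> (pull (cell n F))) x)"
      by (simp add: P_def)
  qed
  with g[OF P, of ?I] show ?thesis by simp
qed

text \<open>In contrast to the representatives, these fibres are countably additive at every point.
  The dominating \<tau> records bounded variation in a form that survives the transport back to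
  \<open>\<Omega>\<close>.\<close>

lemma foliation_on_cantor:
  "\<exists>u. (\<forall>x\<in>space m. vector_measure_on (sets cantor) (u x) \<and> (\<forall>C\<in>sets cantor. u x C \<in> E x) \<and>
        (\<exists>\<tau>. finite_measure \<tau> \<and> sets \<tau> = sets cantor \<and> (\<forall>C\<in>sets cantor. norm (u x C) \<le> measure \<tau> C))) \<and>
    (\<forall>C\<in>sets cantor. (\<lambda>x. u x C) \<in> borel_measurable m \<and> (AE x in m. u x C = R (\<mu> (pull C)) x))"
proof -
  obtain g where g: "\<And>P I. P \<in> borel_partitions \<Omega> \<Omega> \<Longrightarrow> finite I \<Longrightarrow> AE x in m. (\<Sum>n\<in>I. norm (R (\<mu> (P n)) x)) \<le> g x"
    using sums_bounded_AE[OF meas bv] by blast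
  define W where "W x C = R (\<mu> (pull C)) x" for x C
  define good where "good x \<longleftrightarrow>
      (\<forall>A\<in>cylinders. \<forall>B\<in>cylinders. A \<inter> B = {} \<longrightarrow> W x (A \<union> B) = W x A + W x B) \<and>
      (\<forall>n. (\<Sum>F\<in>Pow {..<n}. norm (W x (cell n F))) \<le> g x)" for x
  have W_Un: "AE x in m. W x (A \<union> B) = W x A + W x B"
    if "A \<in> sets cantor" "B \<in> sets cantor" "A \<inter> B = {}" for A B
  proof -
    have "pull (A \<union> B) = pull A \<union> pull B" by blast
    then show ?thesis unfolding W_def using that R_measure_Un[OF pull_sets pull_sets, of A B] by auto
  qed
  have "AE x in m. good x"
    unfolding good_def
  proof (intro AE_conjI)
    show "AE x in m. \<forall>A\<in>cylinders. \<forall>B\<in>cylinders. A \<inter> B = {} \<longrightarrow> W x (A \<union> B) = W x A + W x B"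
      using W_Un cylinders_sets by (simp add: AE_ball_countable countable_cylinders)
    show "AE x in m. \<forall>n. (\<Sum>F\<in>Pow {..<n}. norm (W x (cell n F))) \<le> g x"
      unfolding AE_all_countable W_def using R_pull_cell_sum_bounded[OF g] by blast
  qed
  then obtain N where N: "N \<in> null_sets m" "{x \<in> space m. \<not> good x} \<subseteq> N"
    by (auto elim: AE_E simp: null_sets_def)
  \<comment> \<open>Nothing is known about the measurability of \<open>g\<close>, hence of
    \<open>good\<close>; the complement of a measurable null set takes its place.\<close>
  define G where "G = space m - N"
  have G_sets [measurable]: "G \<in> sets m" using N(1) by (auto simp: G_def)
  have G_AE: "AE x in m. x \<in> G"
    using AE_not_in[OF N(1)] AE_space by eventually_elim (simp add: G_def)
  define Q where "Q x u \<tau> \<longleftrightarrow> finite_measure \<tau> \<and> sets \<tau> = sets cantor \<and> (\<forall>A\<in>cylinders. u A = W x A) \<and>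
      (\<forall>B\<in>sets cantor. norm (u B) \<le> measure \<tau> B \<and> u B \<in> closure (W x ` cylinders)) \<and>
      vector_measure_on (sets cantor) u" for x u \<tau>
  have "\<exists>u \<tau>. Q x u \<tau>" if "x \<in> G" for x
  proof -
    have "good x" using that N(2) by (auto simp: G_def)
    then show ?thesis
      unfolding Q_def good_def by (intro cantor_vector_measure[where c = "g x"]) blast+
  qed
  then obtain U T where UT: "\<And>x. x \<in> G \<Longrightarrow> Q x (U x) (T x)" by metis
  \<comment> \<open>Zero fibres off \<open>G\<close> keep the fibrewise requirements true on all of
    \<open>space m\<close>, as a foliation demands, and measurability in \<open>x\<close> survives
    because \<open>G\<close> is measurable.\<close>
  define u where "u x C = (if x \<in> G then U x C else 0)" for x C
  have vm: "vector_measure_on (sets cantor) (u x)" for x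
  proof (cases "x \<in> G")
    case True
    then have "u x = U x" by (simp add: u_def fun_eq_iff)
    with UT[OF True] show ?thesis by (simp add: Q_def)
  qed (simp add: u_def vector_measure_on_def)
  have dom: "\<exists>\<tau>. finite_measure \<tau> \<and> sets \<tau> = sets cantor \<and> (\<forall>C\<in>sets cantor. norm (u x C) \<le> measure \<tau> C)" for x
  proof (cases "x \<in> G")
    case True
    with UT[OF True] show ?thesis by (auto simp: Q_def u_def intro!: exI[of _ "T x"])
  next
    case False
    have "finite_measure (null_measure cantor)" by (rule finite_measureI) simp
    with False show ?thesis by (auto simp: u_def intro!: exI[of _ "null_measure cantor"])
  qed
  have fib: "u x C \<in> E x" if x: "x \<in> space m" and C: "C \<in> sets cantor" for x C
  proof (cases "x \<in> G")
    case True
    have "W x ` cylinders \<subseteq> E x"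
      unfolding W_def using x by (auto intro!: R_fibre measure_carrier[OF meas] pull_sets cylinders_sets)
    \<comment> \<open>Representatives lie in \<open>E x\<close> at every point, and the extension
      adds only limits.\<close>
    then have "closure (W x ` cylinders) \<subseteq> E x" using closed_fibre[OF x] by (rule closure_minimal)
    with UT[OF True] C True show ?thesis by (auto simp: Q_def u_def)
  qed (simp add: u_def subspace_0 subspace_fibre x)
  have cyl: "(\<lambda>x. u x C) \<in> borel_measurable m \<and> (AE x in m. u x C = W x C)" if "C \<in> cylinders" for C
  proof
    have W: "(\<lambda>x. W x C) \<in> borel_measurable m"
      unfolding W_def using that by (auto intro!: R_measurable measure_carrier[OF meas] pull_sets cylinders_sets)
    have eq: "u x C = (if x \<in> G then W x C else 0)" for x
      using UT[of x] that by (simp add: u_def Q_def)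
    show "(\<lambda>x. u x C) \<in> borel_measurable m" unfolding eq using W by measurable
    show "AE x in m. u x C = W x C" using G_AE by eventually_elim (simp add: eq)
  qed
  have main: "(\<lambda>x. u x C) \<in> borel_measurable m \<and> (AE x in m. u x C = W x C)"
    if "C \<in> sigma_sets UNIV cylinders" for C
    using that
  proof (induction rule: sigma_sets_induct_disjoint[OF Int_stable_cylinders cylinders.space_closed, consumes 1, case_names basic empty compl union])
    case (basic C)
    then show ?case by (rule cyl)
  next
    case empty
    have "u x {} = 0" for x using vm[of x] by (simp add: vector_measure_on_def)
    then show ?case using R_measure_empty by (simp add: W_def)
  next
    case (compl C)
    then have C: "C \<in> sets cantor" "UNIV - C \<in> sets cantor" by (auto simp: sets_cantor sigma_sets.Compl)
    have dec: "u x (UNIV - C) = u x UNIV - u x C" for x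
      using vector_measure_on_Un[OF vm C, of x] by simp
    have U: "(\<lambda>x. u x UNIV) \<in> borel_measurable m" "AE x in m. u x UNIV = W x UNIV"
      using cyl[OF cylinders.top] by blast+
    have IH: "(\<lambda>x. u x C) \<in> borel_measurable m" "AE x in m. u x C = W x C"
      using compl(2) by blast+
    have "AE x in m. W x (C \<union> (UNIV - C)) = W x C + W x (UNIV - C)"
      using C by (intro W_Un) auto
    with U(2) IH(2) have "AE x in m. u x (UNIV - C) = W x (UNIV - C)"
      by eventually_elim (simp add: dec)
    moreover have "(\<lambda>x. u x (UNIV - C)) \<in> borel_measurable m"
      unfolding dec using U(1) IH(1) by measurable
    ultimately show ?case by blast
  next
    case (union C)
    then have C: "range C \<subseteq> sets cantor" by (simp add: sets_cantor)
    have s: "(\<lambda>n. u x (C n)) sums u x (\<Union>n. C n)" for x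
      using union(1) C by (intro vector_measure_onD[OF vm])
    have meas_u: "(\<lambda>x. u x (\<Union>n. C n)) \<in> borel_measurable m"
    proof (rule borel_measurable_LIMSEQ_metric)
      show "(\<lambda>x. \<Sum>n<N. u x (C n)) \<in> borel_measurable m" for N
        using union(3) by (intro borel_measurable_sum) auto
      show "(\<lambda>N. \<Sum>n<N. u x (C n)) \<longlonglongrightarrow> u x (\<Union>n. C n)" for x
        using s[of x] by (simp add: sums_def)
    qed
    have "AE x in m. \<forall>n. u x (C n) = W x (C n)"
      unfolding AE_all_countable using union(3) by blast
    then have "AE x in m. (\<lambda>n. R (\<mu> (pull (C n))) x) sums u x (\<Union>n. C n)"
    proof eventually_elim
      case (elim x)
      with s[of x] show ?case by (simp add: W_def)
    qed
    \<comment> \<open>The fibres are already countably additive, so they supply the pointwise sum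
      that identifies the value of \<open>\<mu>\<close> on the union.\<close>
    then have "AE x in m. R (\<mu> (\<Union>n. pull (C n))) x = u x (\<Union>n. C n)"
      using C union(1) pull_sets by (intro R_measure_Union meas_u) (auto simp: disjoint_family_on_def)
    moreover have "(\<Union>n. pull (C n)) = pull (\<Union>n. C n)" by blast
    ultimately show ?case using meas_u by (simp add: W_def eq_commute)
  qed
  show ?thesis
    by (intro exI[of _ u] conjI ballI vm fib dom)
      (use main in \<open>auto simp: sets_cantor W_def\<close>)
qed

text \<open>Preimages under \<open>\<psi>\<close> respect disjoint countable unions, and the
  dominating \<tau> bounds the total variation of the fibre read back.\<close>

lemma foliation_exists: "\<exists>\<mu>x. foliation m E \<Phi> \<Omega> \<mu> \<mu>x"
proof -
  obtain u where fibrewise: "\<forall>x\<in>space m. vector_measure_on (sets cantor) (u x) \<and> (\<forall>C\<in>sets cantor. u x C \<in> E x) \<and>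
        (\<exists>\<tau>. finite_measure \<tau> \<and> sets \<tau> = sets cantor \<and> (\<forall>C\<in>sets cantor. norm (u x C) \<le> measure \<tau> C))"
    and setwise: "\<forall>C\<in>sets cantor. (\<lambda>x. u x C) \<in> borel_measurable m \<and> (AE x in m. u x C = R (\<mu> (pull C)) x)"
    using foliation_on_cantor by (elim exE conjE)
  have vm: "vector_measure_on (sets cantor) (u x)" if "x \<in> space m" for x
    using fibrewise that by blast
  have "foliation m E \<Phi> \<Omega> \<mu> (\<lambda>x A. u x (\<psi> -` A))"
    unfolding foliation_def
  proof (intro conjI ballI)
    fix x assume x: "x \<in> space m"
    obtain \<tau> where \<tau>: "finite_measure \<tau>" "sets \<tau> = sets cantor" "\<And>C. C \<in> sets cantor \<Longrightarrow> norm (u x C) \<le> measure \<tau> C"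
      using fibrewise x by blast
    interpret \<tau>: finite_measure \<tau> by fact
    have "total_variation \<Omega> (\<lambda>A. u x (\<psi> -` A)) \<Omega> \<le> emeasure \<tau> (\<psi> -` \<Omega>)"
      by (rule total_variation_le_emeasure[where h = "\<lambda>A. \<psi> -` A"])
        (auto simp: \<tau> code_sets \<tau>.emeasure_eq_measure)
    also have "\<dots> < \<infinity>" by (simp add: \<tau>.emeasure_eq_measure)
    finally have tv: "total_variation \<Omega> (\<lambda>A. u x (\<psi> -` A)) \<Omega> < \<infinity>" .
    show "bv_vector_measure \<Omega> (E x) (\<lambda>A. u x (\<psi> -` A))"
      unfolding bv_vector_measure_def
    proof (intro conjI ballI allI impI tv)
      show "u x (\<psi> -` A) \<in> E x" if "A \<in> borel_sets \<Omega>" for A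
        using code_sets(1)[OF that] x fibrewise by blast
      show "u x (\<psi> -` {}) = 0" using vm[OF x] by (simp add: vector_measure_on_def)
      fix A :: "nat \<Rightarrow> 'o set" assume A: "range A \<subseteq> borel_sets \<Omega> \<and> disjoint_family A"
      have "(\<lambda>n. u x (\<psi> -` A n)) sums u x (\<Union>n. \<psi> -` A n)"
        using A code_sets(1)
        by (intro vector_measure_onD[OF vm[OF x]] disjoint_family_on_vimageI) auto
      then show "(\<lambda>n. u x (\<psi> -` A n)) sums u x (\<psi> -` (\<Union>n. A n))" by (simp add: vimage_UN)
    qed
  next
    fix A assume A: "A \<in> borel_sets \<Omega>"
    show "(\<lambda>x. u x (\<psi> -` A)) \<in> borel_measurable (completion m)"
      by (rule measurable_completion) (use setwise code_sets(1)[OF A] in blast)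
    have "AE x in m. R (\<mu> A) x = u x (\<psi> -` A)"
    proof -
      have "AE x in m. u x (\<psi> -` A) = R (\<mu> A) x"
        using setwise[rule_format, OF code_sets(1)[OF A]] unfolding code_sets(2)[OF A] by (rule conjunct2)
      then show ?thesis by eventually_elim simp
    qed
    then show "\<Phi> (\<mu> A) = section_class m E (\<lambda>x. u x (\<psi> -` A))"
      unfolding R_section_and_class(2)[OF measure_carrier[OF meas A]] by (rule section_class_cong)
  qed
  then show ?thesis by blast
qed

text \<open>The foliation is arbitrary, so its fibres need not come from the construction above; the
  extension is applied afresh to each of them, with the image of \<open>\<kappa> x\<close> under
  \<open>\<phi>\<close> as dominating measure.\<close>

lemma foliation_dominated:
  assumes fol: "foliation m E \<Phi> \<Omega> \<mu> \<mu>x" and \<kappa>: "L0_foliation m \<Omega> (L0_mvar m rnorm \<Omega> \<mu>) \<kappa>"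
  shows "AE x in m. \<forall>A \<in> borel_sets \<Omega>. total_variation \<Omega> (\<mu>x x) A \<le> emeasure (\<kappa> x) A"
proof -
  \<comment> \<open>For a fixed set all classes may be compared pointwise; the null set still
    depends on \<open>A\<close>.\<close>
  have le: "AE x in m. norm (\<mu>x x A) \<le> measure (\<kappa> x) A" if A: "A \<in> borel_sets \<Omega>" for A
  proof -
    have "R (\<mu> A) \<in> section_class m E (R (\<mu> A))"
      using R_section_and_class(1)[OF measure_carrier[OF meas A]] by (simp add: section_class_def)
    also have "section_class m E (R (\<mu> A)) = section_class m E (\<lambda>x. \<mu>x x A)"
      using fol A R_section_and_class(2)[OF measure_carrier[OF meas A]] by (simp add: foliation_def)
    finally have 1: "AE x in m. R (\<mu> A) x = \<mu>x x A" by (simp add: section_class_def)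
    have "L0_mvar m rnorm \<Omega> \<mu> A = ae_class m borel (\<lambda>x. measure (\<kappa> x) A)"
      using \<kappa> A by (simp add: L0_foliation_def)
    with rep_L0_mvar_in[OF meas, of A] have 2: "AE x in m. rep (L0_mvar m rnorm \<Omega> \<mu> A) x = measure (\<kappa> x) A"
      by (simp add: ae_class_def)
    from 1 2 norm_le_L0_mvar[OF meas bv A] show ?thesis by eventually_elim simp
  qed
  have "AE x in m. \<forall>C\<in>cylinders. norm (\<mu>x x (pull C)) \<le> measure (\<kappa> x) (pull C)"
    using le pull_sets cylinders_sets by (simp add: AE_ball_countable countable_cylinders)
  with AE_space show ?thesis
  proof eventually_elim
    case (elim x)
    have bvx: "bv_vector_measure \<Omega> (E x) (\<mu>x x)" using fol elim(1) by (simp add: foliation_def)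
    have "finite_radon_measure \<Omega> (\<kappa> x)" using \<kappa> elim(1) by (simp add: L0_foliation_def)
    then have \<kappa>x: "finite_measure (\<kappa> x)" "space (\<kappa> x) = \<Omega>" "sets (\<kappa> x) = borel_sets \<Omega>"
      by (simp_all add: finite_radon_measure_def)
    interpret \<kappa>: finite_measure "\<kappa> x" by fact
    have \<phi>': "\<phi> \<in> measurable (\<kappa> x) cantor"
      using \<phi> measurable_cong_sets[OF \<kappa>x(3) refl] by blast
    define \<tau> where "\<tau> = distr (\<kappa> x) cantor \<phi>"
    have \<tau>: "measure \<tau> C = measure (\<kappa> x) (pull C)" if "C \<in> sets cantor" for C
      unfolding \<tau>_def using measure_distr[OF \<phi>' that] by (simp add: \<kappa>x(2))
    have vm: "vector_measure_on (sets cantor) (\<lambda>C. \<mu>x x (pull C))"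
      unfolding vector_measure_on_def
    proof (intro conjI allI impI)
      show "\<mu>x x (pull {}) = 0" using bvx by (simp add: bv_vector_measure_def)
      fix A :: "nat \<Rightarrow> (nat \<Rightarrow> bool) set" assume A: "range A \<subseteq> sets cantor \<and> disjoint_family A"
      have "range (\<lambda>n. pull (A n)) \<subseteq> borel_sets \<Omega> \<and> disjoint_family (\<lambda>n. pull (A n))"
        using A pull_sets by (intro conjI) (blast, unfold disjoint_family_on_def, blast)
      then have "(\<lambda>n. \<mu>x x (pull (A n))) sums \<mu>x x (\<Union>n. pull (A n))"
        using bvx unfolding bv_vector_measure_def by blast
      moreover have "(\<Union>n. pull (A n)) = pull (\<Union>n. A n)" by blast
      ultimately show "(\<lambda>n. \<mu>x x (pull (A n))) sums \<mu>x x (pull (\<Union>n. A n))" by simp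
    qed
    have le_sets: "norm (\<mu>x x (pull C)) \<le> measure \<tau> C" if C: "C \<in> sets cantor" for C
    proof -
      have 1: "finite_measure \<tau>" unfolding \<tau>_def by (rule \<kappa>.finite_measure_distr[OF \<phi>'])
      have 2: "sets \<tau> = sigma_sets UNIV cylinders" by (simp add: \<tau>_def sets_cantor)
      have 3: "\<mu>x x (pull (A \<union> B)) = \<mu>x x (pull A) + \<mu>x x (pull B)"
        if "A \<in> cylinders" "B \<in> cylinders" "A \<inter> B = {}" for A B
        using that by (intro vector_measure_on_Un[OF vm] cylinders_sets) auto
      have 4: "norm (\<mu>x x (pull A)) \<le> measure \<tau> A" if "A \<in> cylinders" for A
        using elim(2) that by (simp add: \<tau> cylinders_sets)
      have "\<exists>u. (\<forall>A\<in>cylinders. u A = \<mu>x x (pull A)) \<and>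
          (\<forall>B\<in>sets \<tau>. norm (u B) \<le> measure \<tau> B \<and> u B \<in> closure ((\<lambda>A. \<mu>x x (pull A)) ` cylinders)) \<and>
          vector_measure_on (sets \<tau>) u"
        by (rule cylinders.dominated_vector_measure_extension[OF 1 2]) (fact 3, fact 4)
      then obtain u where u: "\<forall>A\<in>cylinders. u A = \<mu>x x (pull A)"
        "\<forall>B\<in>sets \<tau>. norm (u B) \<le> measure \<tau> B \<and> u B \<in> closure ((\<lambda>A. \<mu>x x (pull A)) ` cylinders)"
        "vector_measure_on (sets \<tau>) u"
        by (elim exE conjE)
      \<comment> \<open>The bound is known for the extension \<open>u\<close>; uniqueness from the
        cylinders identifies \<open>u\<close> with the given fibre.\<close>
      have "u C = \<mu>x x (pull C)"
        by (rule vector_measure_on_eqI[OF Int_stable_cylinders cylinders.space_closed cylinders.top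
              u(3)[unfolded 2] vm[unfolded sets_cantor]])
          (use u(1) C in \<open>auto simp: sets_cantor\<close>)
      with u(2) C show ?thesis by (metis 2 sets_cantor)
    qed
    have dom: "ennreal (norm (\<mu>x x B)) \<le> emeasure (\<kappa> x) B" if B: "B \<in> borel_sets \<Omega>" for B
      using le_sets[OF code_sets(1)[OF B]] \<tau>[OF code_sets(1)[OF B]]
      by (simp add: code_sets(2)[OF B] \<kappa>.emeasure_eq_measure)
    show ?case
      using total_variation_le_emeasure[of \<Omega> "\<lambda>A. A" "\<kappa> x" "\<mu>x x"] dom by (simp add: \<kappa>x(3))
  qed
qed

end
end
end

theorem theorem6p3:
  fixes m :: "'x measure"
    and \<Omega> :: "'o::metric_space set"
    and M :: "(('x \<Rightarrow> real) set, 'v) module"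
    and rnorm :: "'v \<Rightarrow> ('x \<Rightarrow> real) set"
    and E :: "'x \<Rightarrow> 'u::{banach, second_countable_topology} set"
    and \<Phi> :: "'v \<Rightarrow> ('x \<Rightarrow> 'u) set"
    and \<mu> :: "'o set \<Rightarrow> 'v"
  assumes "prob_space m"
    and "compact \<Omega>"
    and "random_normed_module m M rnorm"
    and "complete_rnm m M rnorm"
    and "countably_generated_rnm m M rnorm"
    and "universal_separable_banach TYPE('u)"
    and "measurable_banach_bundle m E"
    and "rnm_iso m M rnorm (section_module m E) (section_norm m) \<Phi>"
    and "radon_module_measure m M rnorm \<Omega> \<mu>"
  shows "(\<exists>\<mu>x. foliation m E \<Phi> \<Omega> \<mu> \<mu>x) \<and>
    (\<forall>\<mu>x \<kappa>. foliation m E \<Phi> \<Omega> \<mu> \<mu>x \<and> L0_foliation m \<Omega> (L0_mvar m rnorm \<Omega> \<mu>) \<kappa> \<longrightarrow>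
       (AE x in m. \<forall>A \<in> borel_sets \<Omega>. total_variation \<Omega> (\<mu>x x) A \<le> emeasure (\<kappa> x) A))"
proof -
  interpret sectioned_module m M rnorm E \<Phi>
    using assms(3,7,8) by (simp add: sectioned_module_def sectioned_module_axioms_def)
  have \<mu>: "module_measure m M rnorm \<Omega> \<mu>" "bounded_variation m rnorm \<Omega> \<mu>"
    using assms(9) by (simp_all add: radon_module_measure_def)
  obtain \<phi> :: "'o \<Rightarrow> nat \<Rightarrow> bool" and \<psi>
    where coding: "\<phi> \<in> measurable (restrict_space borel \<Omega>) cantor" "\<psi> \<in> borel_measurable cantor"
      "\<And>\<omega>. \<omega> \<in> \<Omega> \<Longrightarrow> \<psi> (\<phi> \<omega>) = \<omega>"
    using compact_borel_retract_of_cantor[OF assms(2)] by blast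
  note hyps = \<mu>(1) assms(2) \<mu>(2) coding
  show ?thesis
    using foliation_exists[OF hyps] foliation_dominated[OF hyps] by blast
qed

end
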